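(* Let $G$ be an $M\times N$ matrix with independent standard quaternionic Gaussian entries, and for $k\in[n]$ let $D_k$ be a (deterministic) $M\times M$ quaternionic matrix and $W_k=\frac1N G^*D_kG$ the corresponding Wishart matrix (all with the same $G$). Then for all $\iota:\pm[n]\to[N]$ and $\eta:\pm[n]\to\{1,-1\}$, $$\mathbb{E}\big(W^{(1)}_{\iota_1\iota_{-1};\eta_1\eta_{-1}}\cdots W^{(n)}_{\iota_n\iota_{-n};\eta_n\eta_{-n}}\big)=\sum_{\substack{\alpha\in\mathrm{PM}(n)\\ \iota=\iota\circ\delta\alpha\\ \mathrm{sgn}\cdot\eta=(\mathrm{sgn}\circ\alpha)\cdot(\eta\circ\delta\alpha)}}(2N)^{\#(\alpha)/2-n}\Big[\prod_{\substack{k\in[n]\\ -k\in\mathrm{FD}(\alpha)}}\eta_k\eta_{-k}\Big]f(\alpha),$$ where $f:\mathrm{PM}(n)\to\mathbb{C}$ is given by $$f(\alpha)=\mathrm{Re}_{\mathrm{FD}(\alpha^{-1})}\mathrm{tr}_{\mathrm{FD}(\alpha^{-1})}(D_1,\dots,D_n),$$ the trace being normalized by $\frac1N$ (not $\frac1M$) for each cycle.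
   Context: A standard quaternionic Gaussian random variable is $\xi_0+i\xi_1+j\xi_2+k\xi_3$ with $\xi_0,\dots,\xi_3$ independent real $N(0,\tfrac14)$ variables. $A^*$ is the conjugate transpose. The quaternion $a+bi+cj+dk$ is represented by the $2\times2$ complex matrix $\begin{pmatrix}a+bi&c+di\\-c+di&a-bi\end{pmatrix}$, rows and columns indexed by $1,-1$ in this order; $A_{\iota_1\iota_2;\eta_1\eta_2}$ is the $(\eta_1,\eta_2)$ entry of the matrix representing the quaternion $A_{\iota_1\iota_2}$. Write $A^{(k)}$ for $A_k$ and $A^{(-k)}$ for $A_k^*$ when indices are attached. $[n]=\{1,\dots,n\}$, $\pm[n]=[n]\cup(-[n])$, $\delta:k\mapsto-k$, $\mathrm{sgn}(k)$ is the sign of the integer $k$, $\cdot$ is pointwise multiplication of functions, $\#(\alpha)$ is the number of orbits of $\alpha$ on $\pm[n]$. $\mathrm{PM}(n)$ is the set of permutations $\pi$ of $\pm[n]$ with $\delta\pi\delta=\pi^{-1}$ and no $k,-k$ in the same cycle. Its cycles come in pairs (order and signs reversed); $\mathrm{FD}(\pi)$ is the product of those cycles, one from each pair, in which the element of smallest absolute value is positive, and also the set of their elements; $\#(\mathrm{FD}(\pi))=\#(\pi)/2$. For $\pi,\rho\in\mathrm{PM}(n)$ and $M\times M$ quaternionic matrices $D_1,\dots,D_n$, here $$\mathrm{Re}_{\mathrm{FD}(\pi)}\mathrm{tr}_{\mathrm{FD}(\rho)}(D_1,\dots,D_n)=2^{-\#(\mathrm{FD}(\pi))}N^{-\#(\mathrm{FD}(\rho))}\sum_{\substack{i:\pm[n]\to[M]\\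 i_{-k}=i_{\rho(k)}\ \forall k}}\ \sum_{h:\mathrm{FD}(\pi)\to\{1,-1\}}\ \prod_{k\in\mathrm{FD}(\pi)}D^{(k)}_{i_k,i_{-k};h_k,h_{\pi(k)}}.$$ *)

theory Defs
  imports "HOL-Probability.Probability" "HOL-Combinatorics.Combinatorics"
begin

section \<open>Quaternions\<close>

datatype quat = Quat (qre: real) (qi: real) (qj: real) (qk: real)

lemma quat_eq_iff: "p = q \<longleftrightarrow> qre p = qre q \<and> qi p = qi q \<and> qj p = qj q \<and> qk p = qk q"
  by (cases p; cases q) simp

instantiation quat :: real_algebra_1
begin

definition "0 = Quat 0 0 0 0"
definition "1 = Quat 1 0 0 0"
definition "p + q = Quat (qre p + qre q) (qi p + qi q) (qj p + qj q) (qk p + qk q)"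
definition "p - q = Quat (qre p - qre q) (qi p - qi q) (qj p - qj q) (qk p - qk q)"
definition "- q = Quat (- qre q) (- qi q) (- qj q) (- qk q)"
definition "r *\<^sub>R q = Quat (r * qre q) (r * qi q) (r * qj q) (r * qk q)"
definition "p * q = Quat
  (qre p * qre q - qi p * qi q - qj p * qj q - qk p * qk q)
  (qre p * qi q + qi p * qre q + qj p * qk q - qk p * qj q)
  (qre p * qj q - qi p * qk q + qj p * qre q + qk p * qi q)
  (qre p * qk q + qi p * qj q - qj p * qi q + qk p * qre q)"

instance
  by standard
    (simp_all add: quat_eq_iff zero_quat_def one_quat_def plus_quat_def minus_quat_def
      uminus_quat_def scaleR_quat_def times_quat_def algebra_simps)

end

text \<open>The Euclidean structure of \<open>\<real>\<^sup>4\<close>; it provides the topology, hence the Borel sets, of the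
  quaternions.\<close>

instantiation quat :: real_inner
begin

definition "inner p q = qre p * qre q + qi p * qi q + qj p * qj q + qk p * qk q"
definition "norm (q :: quat) = sqrt (inner q q)"
definition "sgn (q :: quat) = q /\<^sub>R norm q"
definition "dist (p :: quat) q = norm (p - q)"
definition "uniformity = (INF e\<in>{0 <..}. principal {(p :: quat, q). dist p q < e})"
definition "open (U :: quat set) \<longleftrightarrow>
  (\<forall>p\<in>U. eventually (\<lambda>(p', q). p' = p \<longrightarrow> q \<in> U) uniformity)"

instance
proof
  fix p q s :: quat and r :: real and U :: "quat set"
  show "dist p q = norm (p - q)" by (rule dist_quat_def)
  show "sgn p = p /\<^sub>R norm p" by (rule sgn_quat_def)
  show "uniformity = (INF e\<in>{0 <..}. principal {(p :: quat, q). dist p q < e})"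
    by (rule uniformity_quat_def)
  show "open U \<longleftrightarrow> (\<forall>p\<in>U. eventually (\<lambda>(p', q). p' = p \<longrightarrow> q \<in> U) uniformity)"
    by (rule open_quat_def)
  show "norm p = sqrt (inner p p)" by (rule norm_quat_def)
  show "inner p q = inner q p" by (simp add: inner_quat_def algebra_simps)
  show "inner (p + q) s = inner p s + inner q s"
    by (simp add: inner_quat_def plus_quat_def algebra_simps)
  show "inner (r *\<^sub>R p) q = r * inner p q"
    by (simp add: inner_quat_def scaleR_quat_def algebra_simps)
  show "0 \<le> inner p p" by (simp add: inner_quat_def)
  have "inner p p = 0 \<longleftrightarrow> qre p * qre p + qi p * qi p = 0 \<and> qj p * qj p + qk p * qk p = 0"
    unfolding inner_quat_def
    by (subst add_nonneg_eq_0_iff[symmetric]) (simp_all add: algebra_simps)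
  then show "inner p p = 0 \<longleftrightarrow> p = 0"
    by (simp add: sum_squares_eq_zero_iff quat_eq_iff zero_quat_def)
qed

end

definition qcnj :: "quat \<Rightarrow> quat" where
  "qcnj q = Quat (qre q) (- qi q) (- qj q) (- qk q)"

text \<open>The representing \<open>2 \<times> 2\<close> complex matrix, with rows and columns indexed by the
  integers \<open>1\<close> and \<open>-1\<close>; values at other indices are irrelevant. (The numeral type
  \<open>2\<close> cannot serve as index type, since there \<open>-1 = 1\<close>.)\<close>

definition quat_entry :: "quat \<Rightarrow> int \<Rightarrow> int \<Rightarrow> complex" where
  "quat_entry q r c =
    (if r = 1 \<and> c = 1 then Complex (qre q) (qi q)
     else if r = 1 \<and> c = -1 then Complex (qj q) (qk q)
     else if r = -1 \<and> c = 1 then Complex (- qj q) (qk q)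
     else if r = -1 \<and> c = -1 then Complex (qre q) (- qi q)
     else 0)"

definition conj_transpose :: "quat^'n^'m \<Rightarrow> quat^'m^'n" where
  "conj_transpose A = (\<chi> a b. qcnj (A $ b $ a))"

definition signed_matrix :: "(int \<Rightarrow> quat^'m^'m) \<Rightarrow> int \<Rightarrow> quat^'m^'m" where
  "signed_matrix D k = (if k > 0 then D k else conj_transpose (D (- k)))"

section \<open>Quaternionic Gaussian and Wishart matrices\<close>

text \<open>The third argument of \<^const>\<open>normal_density\<close> is the point, the second the standard
  deviation, so \<open>1/2\<close> is variance \<open>1/4\<close>.\<close>

definition std_quat_gaussian :: "'w measure \<Rightarrow> ('w \<Rightarrow> quat) \<Rightarrow> bool" where
  "std_quat_gaussian P X \<longleftrightarrow>
    prob_space.indep_vars P (\<lambda>_. borel)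
      (\<lambda>c w. [qre (X w), qi (X w), qj (X w), qk (X w)] ! c) {0..<4::nat} \<and>
    (\<forall>c\<in>{0..<4::nat}. distributed P lborel
      (\<lambda>w. [qre (X w), qi (X w), qj (X w), qk (X w)] ! c) (normal_density 0 (1/2)))"

definition quat_gaussian_matrix :: "'w measure \<Rightarrow> ('w \<Rightarrow> quat^'n^'m) \<Rightarrow> bool" where
  "quat_gaussian_matrix P G \<longleftrightarrow>
    prob_space.indep_vars P (\<lambda>_. borel) (\<lambda>(a, b) w. G w $ a $ b) UNIV \<and>
    (\<forall>a b. std_quat_gaussian P (\<lambda>w. G w $ a $ b))"

definition wishart :: "quat^'n^'m \<Rightarrow> quat^'m^'m \<Rightarrow> quat^'n^'n" where
  "wishart G D = (1 / real CARD('n)) *\<^sub>R (conj_transpose G ** D ** G)"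

section \<open>Permutations of signed integers\<close>

definition pmset :: "nat \<Rightarrow> int set" where
  "pmset n = {1..int n} \<union> uminus ` {1..int n}"

definition PM :: "nat \<Rightarrow> (int \<Rightarrow> int) set" where
  "PM n = {p. p permutes pmset n \<and> uminus \<circ> p \<circ> uminus = inv p \<and>
    (\<forall>k\<in>pmset n. - k \<notin> orbit p k)}"

definition num_orbits :: "(int \<Rightarrow> int) \<Rightarrow> int set \<Rightarrow> nat" where
  "num_orbits p S = card (orbit p ` S)"

text \<open>The set of elements of the cycles making up \<open>FD(p)\<close>. The permutation \<open>FD(p)\<close> is the
  restriction of \<open>p\<close> to this set, so its number of cycles is \<open>num_orbits p (FD n p)\<close>.\<close>

definition FD :: "nat \<Rightarrow> (int \<Rightarrow> int) \<Rightarrow> int set" where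
  "FD n p = {k \<in> pmset n. \<exists>m\<in>orbit p k. 0 < m \<and> (\<forall>l\<in>orbit p k. \<bar>m\<bar> \<le> \<bar>l\<bar>)}"

text \<open>\<open>Re\<^bsub>FD(p)\<^esub> tr\<^bsub>FD(r)\<^esub>(D\<^sub>1, \<dots>, D\<^sub>n)\<close>, each trace normalized by the separate parameter \<open>N\<close>,
  which need not be the dimension of the \<open>D\<^sub>k\<close>.\<close>

definition Re_tr :: "nat \<Rightarrow> nat \<Rightarrow> (int \<Rightarrow> int) \<Rightarrow> (int \<Rightarrow> int) \<Rightarrow> (int \<Rightarrow> quat^'m^'m) \<Rightarrow> complex" where
  "Re_tr N n p r D =
    1 / 2 ^ num_orbits p (FD n p) * (1 / of_nat N ^ num_orbits r (FD n r)) *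
    (\<Sum>i \<in> {i \<in> pmset n \<rightarrow>\<^sub>E (UNIV :: 'm set). \<forall>k\<in>pmset n. i (- k) = i (r k)}.
      \<Sum>h \<in> FD n p \<rightarrow>\<^sub>E {1, -1}.
        \<Prod>k\<in>FD n p. quat_entry (signed_matrix D k $ i k $ i (- k)) (h k) (h (p k)))"

end

theory Submission
  imports Defs
begin

text \<open>The proof is Wick's theorem followed by bookkeeping of signs.

Expanding every \<open>W\<^sub>k = (1/N) G\<^sup>* D\<^sub>k G\<close> writes the product as a sum, over one matrix index and one
sign for each element of \<open>pmset n\<close>, of a product of entries of the \<open>D\<^sub>k\<close> and of \<open>2n\<close> entries of
\<open>G\<close>: the \<open>k\<close>-th factor contributes one entry at position \<open>k\<close>, from \<open>G\<^sup>*\<close>, and one at position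
\<open>-k\<close>. An entry of the conjugate quaternion is, up to sign, an entry of the quaternion with negated
indices (\<open>quat_entry_qcnj\<close>), so only entries of \<open>G\<close> itself occur. They are complex linear forms in
independent centred real Gaussians, and the expectation of their product is the sum over all pairings
of \<open>pmset n\<close> of the products of covariances (\<open>quat_gaussian_matrix_wick\<close>).

A pairing \<open>p\<close> is a fixed-point-free involution, and \<open>\<alpha> = \<delta>p\<close> identifies the pairings of \<open>pmset n\<close>
with \<open>PM(n)\<close> (\<open>sum_pairings_pmset\<close>): \<open>p\<close> is an involution because \<open>\<delta>\<alpha>\<delta> = \<alpha>\<inverse>\<close>, and \<open>p\<close>
having no fixed point amounts to no cycle of \<open>\<alpha>\<close> containing some \<open>k\<close> together with \<open>-k\<close>. The
set \<open>FD(\<alpha>)\<close> contains exactly one of \<open>k, -k\<close>, and, being a union of cycles, exactly one element of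
every pair \<open>{k, -\<alpha> k}\<close>. It therefore serves both to list the pairs and to list the matrices
\<open>D\<^sub>k\<close>.

For fixed \<open>\<alpha>\<close> the covariances vanish unless \<open>\<iota>\<close> and \<open>\<eta>\<close> satisfy the two conditions of the
statement and the summation indices satisfy the analogous ones (\<open>prod_entry_cov_negate_on\<close>). The
remaining sum is \<open>Re_tr\<close> taken along \<open>inv \<alpha>\<close>, up to its normalisation and the signs
\<open>\<eta>\<^sub>k \<eta>\<^sub>-\<^sub>k\<close> of those \<open>k\<close> for which \<open>D\<^sub>k\<close> enters through its adjoint
(\<open>sum_compatible_labels\<close>). The power of \<open>2N\<close> collects a factor \<open>1/N\<close> from each \<open>W\<^sub>k\<close>, a factor
\<open>1/2\<close> from each covariance, and the normalisation of \<open>Re_tr\<close>.\<close>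

section \<open>Entries of the representing matrices\<close>

lemma quat_entry_add:
  "quat_entry (p + q) r c = quat_entry p r c + quat_entry q r c"
  by (simp add: quat_entry_def plus_quat_def complex_eq_iff)

lemma quat_entry_sum: "quat_entry (\<Sum>x\<in>A. f x) r c = (\<Sum>x\<in>A. quat_entry (f x) r c)"
proof (induction A rule: infinite_finite_induct)
  case (insert x A)
  then show ?case by (simp add: quat_entry_add)
qed (simp_all add: quat_entry_def zero_quat_def complex_eq_iff)

lemma quat_entry_scaleR: "quat_entry (x *\<^sub>R q) r c = of_real x * quat_entry q r c"
  by (simp add: quat_entry_def scaleR_quat_def complex_eq_iff)

lemma quat_entry_mult:
  assumes "r \<in> {1, -1}" "c \<in> {1, -1}"
  shows "quat_entry (p * q) r c = (\<Sum>h\<in>{1, -1}. quat_entry p r h * quat_entry q h c)"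
proof -
  have "(r = 1 \<or> r = -1) \<and> (c = 1 \<or> c = -1)" using assms by blast
  then show ?thesis
    by (elim conjE disjE; simp add: quat_entry_def times_quat_def; simp add: complex_eq_iff)
qed

text \<open>This turns the entries of \<open>G\<^sup>*\<close> into entries of \<open>G\<close>, at the price of a sign and of negated
indices, so that a single covariance formula covers all pairs of factors.\<close>

lemma quat_entry_qcnj:
  assumes "r \<in> {1, -1}" "c \<in> {1, -1}"
  shows "quat_entry (qcnj q) r c = of_int (r * c) * quat_entry q (- c) (- r)"
proof -
  have "(r = 1 \<or> r = -1) \<and> (c = 1 \<or> c = -1)" using assms by blast
  then show ?thesis
    by (elim conjE disjE; simp add: quat_entry_def qcnj_def; simp add: complex_eq_iff)
qed

text \<open>The wanted formula is complex while the Gaussians are real, so an entry of the representing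
matrix is read as a complex linear form in the four real coordinates \<open>coord t\<close> of the
quaternion; \<open>entry_coeff r c t\<close> is the coefficient of coordinate \<open>t\<close> in entry \<open>(r, c)\<close>.\<close>

definition coord :: "nat \<Rightarrow> quat \<Rightarrow> real" where
  "coord t q = [qre q, qi q, qj q, qk q] ! t"

definition quat_unit :: "nat \<Rightarrow> quat" where
  "quat_unit t = Quat (of_bool (t = 0)) (of_bool (t = 1)) (of_bool (t = 2)) (of_bool (t = 3))"

definition entry_coeff :: "int \<Rightarrow> int \<Rightarrow> nat \<Rightarrow> complex" where
  "entry_coeff r c t = quat_entry (quat_unit t) r c"

lemma lessThan_4: "{..<4::nat} = {0, 1, 2, 3}"
  by auto

lemma quat_eq_sum_coord: "q = (\<Sum>t<4. coord t q *\<^sub>R quat_unit t)"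
  unfolding lessThan_4
  by (simp add: coord_def quat_unit_def quat_eq_iff plus_quat_def scaleR_quat_def zero_quat_def)

lemma quat_entry_eq_sum_coord:
  "quat_entry q r c = (\<Sum>t<4. entry_coeff r c t * of_real (coord t q))"
  by (subst quat_eq_sum_coord)
    (simp add: quat_entry_sum quat_entry_scaleR entry_coeff_def mult.commute)

text \<open>Up to the factor \<open>1/4\<close>, the variance of a coordinate, this is the covariance of two entries of one
standard quaternionic Gaussian. The product carries no complex conjugate, so an entry is correlated
only with the one that is its conjugate up to sign, diagonally opposite in the representing matrix.\<close>

lemma sum_entry_coeff_mult:
  assumes "r \<in> {1, -1}" "c \<in> {1, -1}" "r' \<in> {1, -1}" "c' \<in> {1, -1}"
  shows "(\<Sum>t<4. entry_coeff r c t * entry_coeff r' c' t) =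
    (if r' = - r \<and> c' = - c then 2 * of_int (r * c) else 0)"
proof -
  have "(r = 1 \<or> r = -1) \<and> (c = 1 \<or> c = -1) \<and> (r' = 1 \<or> r' = -1) \<and> (c' = 1 \<or> c' = -1)"
    using assms by blast
  then show ?thesis
    unfolding lessThan_4 entry_coeff_def quat_entry_def quat_unit_def
    by (elim conjE disjE; simp; simp add: complex_eq_iff)
qed

lemma borel_measurable_coord: "t < 4 \<Longrightarrow> coord t \<in> borel_measurable borel"
proof -
  assume t: "t < 4"
  have "coord t = (\<lambda>q. inner q (quat_unit t))"
    using t by (auto simp: fun_eq_iff coord_def quat_unit_def inner_quat_def eval_nat_numeral less_Suc_eq)
  moreover have "continuous_on UNIV \<dots>"
    by (intro continuous_intros)
  ultimately show ?thesis
    by (metis borel_measurable_continuous_onI)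
qed

section \<open>Moments of the real coordinates\<close>

text \<open>The moments of \<open>N(0, v)\<close>, in the form of the integration by parts identity
\<open>E(X\<^sup>m\<^sup>+\<^sup>2) = (m + 1) v E(X\<^sup>m)\<close> on which the Wick recursion is built.\<close>

fun gauss_moment :: "real \<Rightarrow> nat \<Rightarrow> real" where
  "gauss_moment v 0 = 1"
| "gauss_moment v (Suc 0) = 0"
| "gauss_moment v (Suc (Suc m)) = real (Suc m) * v * gauss_moment v m"

lemma gauss_moment_odd: "gauss_moment v (2 * k + 1) = 0"
  by (induction k) simp_all

lemma gauss_moment_even: "gauss_moment v (2 * k) = fact (2 * k) * v ^ k / (2 ^ k * fact k)"
proof (induction k)
  case (Suc k)
  then have "gauss_moment v (2 * Suc k) = (2 * real k + 1) * v * (fact (2 * k) * v ^ k / (2 ^ k * fact k))"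
    by simp
  also have "\<dots> = fact (2 * Suc k) * v ^ Suc k / (2 ^ Suc k * fact (Suc k))"
    by (simp add: divide_simps)
  finally show ?case .
qed simp

lemma normal_moment:
  assumes "\<sigma> > 0"
  shows "has_bochner_integral lborel (\<lambda>x. normal_density 0 \<sigma> x * x ^ m) (gauss_moment (\<sigma>\<^sup>2) m)"
proof (cases "even m")
  case True
  then obtain k where k: "m = 2 * k" by (auto elim: evenE)
  show ?thesis
    using normal_moment_even[OF assms, of 0 k]
    by (simp only: k gauss_moment_even diff_0_right power_divide) (simp add: field_simps)
next
  case False
  then obtain k where k: "m = 2 * k + 1" by (auto elim: oddE)
  show ?thesis
    using normal_moment_odd[OF assms, of 0 k] by (simp only: k gauss_moment_odd diff_0_right)
qed

lemma distributed_normal_moment: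
  assumes "distributed P lborel X (normal_density 0 \<sigma>)" "\<sigma> > 0"
  shows "has_bochner_integral P (\<lambda>w. X w ^ m) (gauss_moment (\<sigma>\<^sup>2) m)"
proof -
  note m = normal_moment[OF assms(2), of m]
  have "integrable P (\<lambda>w. X w ^ m)"
    using distributed_integrable[OF assms(1), of "\<lambda>x. x ^ m"] m
    by (simp add: has_bochner_integral_iff)
  moreover have "(\<integral>w. X w ^ m \<partial>P) = gauss_moment (\<sigma>\<^sup>2) m"
    using distributed_integral[OF assms(1), of "\<lambda>x. x ^ m"] m
    by (simp add: has_bochner_integral_iff)
  ultimately show ?thesis by (simp add: has_bochner_integral_iff)
qed

lemma (in prob_space) indep_vars_has_bochner_integral_prod:
  fixes X :: "'i \<Rightarrow> 'a \<Rightarrow> real"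
  assumes "finite I" "indep_vars (\<lambda>_. borel) X I"
    and "\<And>i. i \<in> I \<Longrightarrow> has_bochner_integral M (X i) (c i)"
  shows "has_bochner_integral M (\<lambda>w. \<Prod>i\<in>I. X i w) (\<Prod>i\<in>I. c i)"
proof -
  have 1: "\<And>i. i \<in> I \<Longrightarrow> integrable M (X i)" and 2: "\<And>i. i \<in> I \<Longrightarrow> integral\<^sup>L M (X i) = c i"
    using assms(3) by (auto simp: has_bochner_integral_iff)
  have "expectation (\<lambda>w. \<Prod>i\<in>I. X i w) = (\<Prod>i\<in>I. c i)"
    using indep_vars_lebesgue_integral[OF assms(1,2) 1] 2 by simp
  then show ?thesis
    using indep_vars_integrable[OF assms(1,2) 1] by (simp add: has_bochner_integral_iff)
qed

text \<open>Independence holds at two levels, between the entries and between the four coordinates of one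
entry, so the product rule for expectations is applied once at each level.\<close>

lemma quat_gaussian_matrix_moments:
  fixes G :: "'w \<Rightarrow> quat^'n^'m" and m :: "'m \<times> 'n \<times> nat \<Rightarrow> nat"
  assumes P: "prob_space P" and G: "quat_gaussian_matrix P G"
  shows "has_bochner_integral P
    (\<lambda>w. \<Prod>(a, b, t)\<in>UNIV \<times> UNIV \<times> {..<4}. coord t (G w $ a $ b) ^ m (a, b, t))
    (\<Prod>x\<in>UNIV \<times> UNIV \<times> {..<4}. gauss_moment (1/4) (m x))"
proof -
  interpret prob_space P by fact
  define H where "H = (\<lambda>ab w. \<Prod>t<4. coord t (G w $ fst ab $ snd ab) ^ m (fst ab, snd ab, t))"
  have H: "has_bochner_integral P (H ab) (\<Prod>t<4. gauss_moment (1/4) (m (fst ab, snd ab, t)))" for ab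
  proof -
    obtain a b where ab: "ab = (a, b)" by (cases ab)
    have s: "std_quat_gaussian P (\<lambda>w. G w $ a $ b)"
      using G by (simp add: quat_gaussian_matrix_def)
    have i: "indep_vars (\<lambda>_. borel) (\<lambda>t w. coord t (G w $ a $ b)) {..<4::nat}"
      and d: "\<And>t. t < 4 \<Longrightarrow> distributed P lborel (\<lambda>w. coord t (G w $ a $ b)) (normal_density 0 (1/2))"
      using s by (simp_all add: std_quat_gaussian_def coord_def[abs_def] atLeast0LessThan)
    have "has_bochner_integral P (\<lambda>w. \<Prod>t<4. coord t (G w $ a $ b) ^ m (a, b, t))
      (\<Prod>t<4. gauss_moment (1/4) (m (a, b, t)))"
    proof (rule indep_vars_has_bochner_integral_prod)
      show "indep_vars (\<lambda>_. borel) (\<lambda>t w. coord t (G w $ a $ b) ^ m (a, b, t)) {..<4}"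
        by (rule indep_vars_compose2[OF i]) simp
      show "has_bochner_integral P (\<lambda>w. coord t (G w $ a $ b) ^ m (a, b, t))
          (gauss_moment (1/4) (m (a, b, t)))" if "t \<in> {..<4}" for t
        using distributed_normal_moment[OF d, of t "m (a, b, t)"] that by (simp add: power2_eq_square)
    qed simp
    then show ?thesis by (simp add: ab H_def)
  qed
  have "indep_vars (\<lambda>_. borel) (\<lambda>ab w. H ab w) UNIV"
  proof -
    have "indep_vars (\<lambda>_. borel) (\<lambda>(a, b) w. G w $ a $ b) UNIV"
      using G by (simp add: quat_gaussian_matrix_def)
    moreover have "(\<lambda>q. \<Prod>t<4. coord t q ^ m (fst ab, snd ab, t)) \<in> borel_measurable borel" for ab
      by (auto intro!: borel_measurable_prod borel_measurable_power borel_measurable_coord)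
    ultimately have "indep_vars (\<lambda>_. borel)
        (\<lambda>ab w. \<Prod>t<4. coord t ((\<lambda>(a, b) w. G w $ a $ b) ab w) ^ m (fst ab, snd ab, t)) UNIV"
      by (rule indep_vars_compose2)
    then show ?thesis
      by (simp add: H_def case_prod_beta')
  qed
  from indep_vars_has_bochner_integral_prod[OF _ this H]
  have "has_bochner_integral P (\<lambda>w. \<Prod>ab\<in>UNIV. H ab w)
      (\<Prod>ab\<in>UNIV. \<Prod>t<4. gauss_moment (1/4) (m (fst ab, snd ab, t)))"
    by simp
  also have "(\<lambda>w. \<Prod>ab\<in>UNIV. H ab w) =
      (\<lambda>w. \<Prod>(a, b, t)\<in>UNIV \<times> UNIV \<times> {..<4}. coord t (G w $ a $ b) ^ m (a, b, t))"
    unfolding H_def UNIV_Times_UNIV[symmetric]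
    by (simp only: prod.cartesian_product' prod.case fst_conv snd_conv)
  also have "(\<Prod>ab\<in>UNIV. \<Prod>t<4. gauss_moment (1/4) (m (fst ab, snd ab, t))) =
      (\<Prod>x\<in>UNIV \<times> UNIV \<times> {..<4}. gauss_moment (1/4) (m x))"
    unfolding UNIV_Times_UNIV[symmetric]
    by (simp only: prod.cartesian_product' prod.case fst_conv snd_conv)
  finally show ?thesis .
qed

section \<open>Expectations of products of Gaussian linear forms\<close>

text \<open>The expectation of \<open>\<Prod>j\<in>S. \<Sum>x\<in>C. A j x X\<^sub>x\<close> for independent \<open>N(0, v)\<close> variables
\<open>X\<^sub>x\<close>, expanded over all choices \<open>f\<close> of one summand per factor.\<close>

definition linear_forms_moment :: "real \<Rightarrow> 'c set \<Rightarrow> ('j \<Rightarrow> 'c \<Rightarrow> complex) \<Rightarrow> 'j set \<Rightarrow> complex" where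
  "linear_forms_moment v C A S = (\<Sum>f\<in>S \<rightarrow>\<^sub>E C. (\<Prod>j\<in>S. A j (f j)) *
    of_real (\<Prod>x\<in>C. gauss_moment v (card {j\<in>S. f j = x})))"

lemma has_bochner_integral_linear_forms:
  fixes X :: "'c \<Rightarrow> 'w \<Rightarrow> real" and A :: "'j \<Rightarrow> 'c \<Rightarrow> complex"
  assumes "finite C" "finite S"
    and mom: "\<And>m. has_bochner_integral P (\<lambda>w. \<Prod>x\<in>C. X x w ^ m x) (\<Prod>x\<in>C. gauss_moment v (m x))"
  shows "has_bochner_integral P (\<lambda>w. \<Prod>j\<in>S. \<Sum>x\<in>C. A j x * of_real (X x w))
    (linear_forms_moment v C A S)"
proof -
  have "(\<Prod>j\<in>S. \<Sum>x\<in>C. A j x * of_real (X x w)) = (\<Sum>f\<in>S \<rightarrow>\<^sub>E C. (\<Prod>j\<in>S. A j (f j)) *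
    of_real (\<Prod>x\<in>C. X x w ^ card {j\<in>S. f j = x}))" for w
  proof -
    have "(\<Prod>j\<in>S. X (f j) w) = (\<Prod>x\<in>C. X x w ^ card {j\<in>S. f j = x})" if "f \<in> S \<rightarrow>\<^sub>E C" for f
    proof -
      have "(\<Prod>j\<in>S. X (f j) w) = (\<Prod>x\<in>C. \<Prod>j\<in>{j\<in>S. f j = x}. X (f j) w)"
        using assms(1,2) that by (intro prod.group[symmetric]) auto
      also have "\<dots> = (\<Prod>x\<in>C. X x w ^ card {j\<in>S. f j = x})"
        by (intro prod.cong refl) simp
      finally show ?thesis .
    qed
    then show ?thesis
      using assms(1,2)
      by (simp add: prod_sum_PiE prod.distrib flip: of_real_prod)
  qed
  then show ?thesis
    unfolding linear_forms_moment_def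
    by (simp only:) (intro has_bochner_integral_sum has_bochner_integral_mult_right
      has_bochner_integral_of_real mom)
qed

text \<open>Only the power of \<open>X\<close> at \<open>f j\<^sub>0\<close> changes when \<open>j\<^sub>0\<close> is added. If \<open>k\<close> indices of \<open>T\<close> are mapped
to that coordinate, its \<open>(k + 1)\<close>-st moment is \<open>k v\<close> times the \<open>(k - 1)\<close>-st one, and the factor
\<open>k\<close> counts the possible partners \<open>j\<^sub>1\<close> of \<open>j\<^sub>0\<close>.\<close>

lemma coordinate_moment_insert:
  fixes f :: "'j \<Rightarrow> 'c"
  assumes "finite C" "finite T" "j\<^sub>0 \<notin> T" "f j\<^sub>0 \<in> C"
  shows "(\<Prod>x\<in>C. gauss_moment v (card {j\<in>insert j\<^sub>0 T. f j = x})) =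
    (\<Sum>j\<^sub>1\<in>T. if f j\<^sub>1 = f j\<^sub>0 then v * (\<Prod>x\<in>C. gauss_moment v (card {j\<in>T - {j\<^sub>1}. f j = x})) else 0)"
proof -
  define F where "F = {j\<in>T. f j = f j\<^sub>0}"
  define R where "R = (\<Prod>x\<in>C - {f j\<^sub>0}. gauss_moment v (card {j\<in>T. f j = x}))"
  have fin: "finite F" using assms(2) by (simp add: F_def)
  have split: "(\<Prod>x\<in>C. h x) = h (f j\<^sub>0) * (\<Prod>x\<in>C - {f j\<^sub>0}. h x)" for h :: "'c \<Rightarrow> real"
    using assms by (simp add: prod.remove)
  have "{j\<in>insert j\<^sub>0 T. f j = f j\<^sub>0} = insert j\<^sub>0 F"
    by (auto simp: F_def)
  then have "card {j\<in>insert j\<^sub>0 T. f j = f j\<^sub>0} = Suc (card F)"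
    using fin assms(3) by (simp add: F_def)
  moreover have "{j\<in>insert j\<^sub>0 T. f j = x} = {j\<in>T. f j = x}" if "x \<noteq> f j\<^sub>0" for x
    using that by auto
  ultimately have lhs: "(\<Prod>x\<in>C. gauss_moment v (card {j\<in>insert j\<^sub>0 T. f j = x})) =
      gauss_moment v (Suc (card F)) * R"
    by (subst split) (simp add: R_def)
  have "(\<Prod>x\<in>C. gauss_moment v (card {j\<in>T - {j\<^sub>1}. f j = x})) = gauss_moment v (card F - 1) * R"
    if "j\<^sub>1 \<in> F" for j\<^sub>1
  proof -
    have "{j\<in>T - {j\<^sub>1}. f j = f j\<^sub>0} = F - {j\<^sub>1}" by (auto simp: F_def)
    then have "card {j\<in>T - {j\<^sub>1}. f j = f j\<^sub>0} = card F - 1"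
      using that fin by simp
    moreover have "{j\<in>T - {j\<^sub>1}. f j = x} = {j\<in>T. f j = x}" if "x \<noteq> f j\<^sub>0" for x
      using that \<open>j\<^sub>1 \<in> F\<close> by (auto simp: F_def)
    ultimately show ?thesis
      by (subst split) (simp add: R_def)
  qed
  then have "(\<Sum>j\<^sub>1\<in>T. if f j\<^sub>1 = f j\<^sub>0 then v * (\<Prod>x\<in>C. gauss_moment v (card {j\<in>T - {j\<^sub>1}. f j = x})) else 0)
      = (\<Sum>j\<^sub>1\<in>F. v * (gauss_moment v (card F - 1) * R))"
    unfolding F_def using assms(2)
    by (subst sum.inter_filter[symmetric]) (auto simp: F_def intro!: sum.cong)
  also have "\<dots> = gauss_moment v (Suc (card F)) * R"
    by (cases "card F") simp_all
  finally show ?thesis using lhs by simp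
qed

lemma sum_PiE_insert:
  fixes F :: "('a \<Rightarrow> 'b) \<Rightarrow> 'c::comm_monoid_add"
  assumes "j \<notin> S"
  shows "(\<Sum>f\<in>insert j S \<rightarrow>\<^sub>E C. F f) = (\<Sum>x\<in>C. \<Sum>g\<in>S \<rightarrow>\<^sub>E C. F (g(j := x)))"
  unfolding PiE_insert_eq sum.cartesian_product
  by (subst sum.reindex[OF inj_combinator[OF assms]]) (simp add: case_prod_beta')

text \<open>Gaussian integration by parts: by multilinearity the recursion for coordinates carries over to
linear forms, where the factor \<open>j\<^sub>0\<close> is contracted with each other factor \<open>j\<^sub>1\<close> in turn.\<close>

lemma linear_forms_moment_insert:
  fixes A :: "'j \<Rightarrow> 'c \<Rightarrow> complex"
  assumes C: "finite C" and T: "finite T" "j\<^sub>0 \<notin> T"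
  shows "linear_forms_moment v C A (insert j\<^sub>0 T) =
    (\<Sum>j\<^sub>1\<in>T. (of_real v * (\<Sum>x\<in>C. A j\<^sub>0 x * A j\<^sub>1 x)) * linear_forms_moment v C A (T - {j\<^sub>1}))"
proof -
  define R where "R T f = (of_real (\<Prod>x\<in>C. gauss_moment v (card {j\<in>T. f j = x})) :: complex)" for T :: "'j set" and f :: "'j \<Rightarrow> 'c"
  have R_cong: "R U f = R U g" if "\<And>j. j \<in> U \<Longrightarrow> f j = g j" for U :: "'j set" and f g :: "'j \<Rightarrow> 'c"
    using that by (simp add: R_def cong: conj_cong)
  have R_insert: "R (insert j\<^sub>0 T) (g(j\<^sub>0 := x)) =
      (\<Sum>j\<^sub>1\<in>T. if g j\<^sub>1 = x then of_real v * R (T - {j\<^sub>1}) g else 0)" if "x \<in> C" for x g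
  proof -
    have eq: "R (T - {j\<^sub>1}) g = R (T - {j\<^sub>1}) (g(j\<^sub>0 := x))" for j\<^sub>1
      using T(2) by (intro R_cong) auto
    have "R (insert j\<^sub>0 T) (g(j\<^sub>0 := x)) = (\<Sum>j\<^sub>1\<in>T. if (g(j\<^sub>0 := x)) j\<^sub>1 = (g(j\<^sub>0 := x)) j\<^sub>0
        then of_real v * R (T - {j\<^sub>1}) (g(j\<^sub>0 := x)) else 0)"
      unfolding R_def using coordinate_moment_insert[OF C T, of "g(j\<^sub>0 := x)" v] that
      by (simp del: of_real_prod add: of_real_sum if_distrib[of of_real] cong: if_cong)
    also have "\<dots> = (\<Sum>j\<^sub>1\<in>T. if g j\<^sub>1 = x then of_real v * R (T - {j\<^sub>1}) g else 0)"
      unfolding eq using T(2) by (intro sum.cong) auto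
    finally show ?thesis .
  qed
  have "linear_forms_moment v C A (insert j\<^sub>0 T) =
      (\<Sum>x\<in>C. \<Sum>g\<in>T \<rightarrow>\<^sub>E C. (\<Prod>j\<in>insert j\<^sub>0 T. A j ((g(j\<^sub>0 := x)) j)) * R (insert j\<^sub>0 T) (g(j\<^sub>0 := x)))"
    unfolding linear_forms_moment_def R_def[symmetric] by (rule sum_PiE_insert[OF T(2)])
  also have "\<dots> = (\<Sum>x\<in>C. \<Sum>g\<in>T \<rightarrow>\<^sub>E C. \<Sum>j\<^sub>1\<in>T. if g j\<^sub>1 = x
      then A j\<^sub>0 x * (\<Prod>j\<in>T. A j (g j)) * (of_real v * R (T - {j\<^sub>1}) g) else 0)"
  proof (intro sum.cong refl)
    fix x g assume x: "x \<in> C"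
    have "(\<Prod>j\<in>insert j\<^sub>0 T. A j ((g(j\<^sub>0 := x)) j)) = A j\<^sub>0 x * (\<Prod>j\<in>T. A j (g j))"
      using T by (auto intro!: arg_cong2[where f = "(*)"] prod.cong)
    then show "(\<Prod>j\<in>insert j\<^sub>0 T. A j ((g(j\<^sub>0 := x)) j)) * R (insert j\<^sub>0 T) (g(j\<^sub>0 := x)) =
      (\<Sum>j\<^sub>1\<in>T. if g j\<^sub>1 = x then A j\<^sub>0 x * (\<Prod>j\<in>T. A j (g j)) * (of_real v * R (T - {j\<^sub>1}) g) else 0)"
      using R_insert[OF x, of g] by (simp add: sum_distrib_left if_distrib cong: if_cong)
  qed
  also have "\<dots> = (\<Sum>j\<^sub>1\<in>T. \<Sum>g\<in>T \<rightarrow>\<^sub>E C. \<Sum>x\<in>C. if g j\<^sub>1 = x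
      then A j\<^sub>0 x * (\<Prod>j\<in>T. A j (g j)) * (of_real v * R (T - {j\<^sub>1}) g) else 0)"
    by (subst sum.swap, subst (2) sum.swap, subst sum.swap, rule refl)
  also have "\<dots> = (\<Sum>j\<^sub>1\<in>T. (of_real v * (\<Sum>x\<in>C. A j\<^sub>0 x * A j\<^sub>1 x)) * linear_forms_moment v C A (T - {j\<^sub>1}))"
  proof (rule sum.cong[OF refl])
    fix j\<^sub>1 assume j1: "j\<^sub>1 \<in> T"
    define U where "U = T - {j\<^sub>1}"
    have U: "T = insert j\<^sub>1 U" "j\<^sub>1 \<notin> U" "finite U" using j1 T(1) by (auto simp: U_def)
    have "(\<Sum>g\<in>T \<rightarrow>\<^sub>E C. \<Sum>x\<in>C. if g j\<^sub>1 = x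
        then A j\<^sub>0 x * (\<Prod>j\<in>T. A j (g j)) * (of_real v * R U g) else 0) =
      (\<Sum>g\<in>T \<rightarrow>\<^sub>E C. A j\<^sub>0 (g j\<^sub>1) * (\<Prod>j\<in>T. A j (g j)) * (of_real v * R U g))"
      using j1 C by (intro sum.cong refl) (auto simp: sum.delta')
    also have "\<dots> = (\<Sum>x\<in>C. \<Sum>g\<in>U \<rightarrow>\<^sub>E C.
        A j\<^sub>0 x * (\<Prod>j\<in>T. A j ((g(j\<^sub>1 := x)) j)) * (of_real v * R U (g(j\<^sub>1 := x))))"
      unfolding U(1) by (subst sum_PiE_insert[OF U(2)]) simp
    also have "\<dots> = (\<Sum>x\<in>C. \<Sum>g\<in>U \<rightarrow>\<^sub>E C.
        (of_real v * (A j\<^sub>0 x * A j\<^sub>1 x)) * ((\<Prod>j\<in>U. A j (g j)) * R U g))"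
    proof (intro sum.cong refl)
      fix x g
      have "R U (g(j\<^sub>1 := x)) = R U g" using U(2) by (intro R_cong) auto
      moreover have "(\<Prod>j\<in>T. A j ((g(j\<^sub>1 := x)) j)) = A j\<^sub>1 x * (\<Prod>j\<in>U. A j (g j))"
        unfolding U(1) using U(2,3) by (auto intro!: arg_cong2[where f = "(*)"] prod.cong)
      ultimately show "A j\<^sub>0 x * (\<Prod>j\<in>T. A j ((g(j\<^sub>1 := x)) j)) * (of_real v * R U (g(j\<^sub>1 := x))) =
        (of_real v * (A j\<^sub>0 x * A j\<^sub>1 x)) * ((\<Prod>j\<in>U. A j (g j)) * R U g)"
        by simp
    qed
    also have "\<dots> = (of_real v * (\<Sum>x\<in>C. A j\<^sub>0 x * A j\<^sub>1 x)) * linear_forms_moment v C A U"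
      unfolding linear_forms_moment_def R_def
      by (simp only: sum_distrib_left sum_distrib_right) (rule sum.swap)
    finally show "(\<Sum>g\<in>T \<rightarrow>\<^sub>E C. \<Sum>x\<in>C. if g j\<^sub>1 = x
        then A j\<^sub>0 x * (\<Prod>j\<in>T. A j (g j)) * (of_real v * R (T - {j\<^sub>1}) g) else 0) =
      (of_real v * (\<Sum>x\<in>C. A j\<^sub>0 x * A j\<^sub>1 x)) * linear_forms_moment v C A (T - {j\<^sub>1})"
      unfolding U_def .
  qed
  finally show ?thesis .
qed

section \<open>Sums over pairings\<close>

text \<open>A perfect matching of \<open>S\<close>, encoded as the fixed-point-free involution exchanging partners. It is
the identity off \<open>S\<close>, so that distinct elements are distinct matchings.\<close>

definition pairings :: "'a set \<Rightarrow> ('a \<Rightarrow> 'a) set" where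
  "pairings S = {p. (\<forall>k. k \<notin> S \<longrightarrow> p k = k) \<and> (\<forall>k\<in>S. p k \<in> S \<and> p k \<noteq> k \<and> p (p k) = k)}"

lemma pairings_involution: "p \<in> pairings S \<Longrightarrow> p (p k) = k"
  by (cases "k \<in> S") (auto simp: pairings_def)

lemma pairings_permutes:
  assumes "p \<in> pairings S"
  shows "p permutes S"
  unfolding permutes_def
proof (intro conjI allI impI)
  show "\<exists>!x. p x = y" for y
    using pairings_involution[OF assms] by metis
qed (use assms in \<open>auto simp: pairings_def\<close>)

lemma sum_pairings_insert:
  fixes F :: "('a \<Rightarrow> 'a) \<Rightarrow> 'b::comm_monoid_add"
  assumes "finite T" "x \<notin> T"
  shows "(\<Sum>p\<in>pairings (insert x T). F p) =
    (\<Sum>y\<in>T. \<Sum>q\<in>pairings (T - {y}). F (q(x := y, y := x)))"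
proof -
  have fin: "finite (pairings S)" if "finite S" for S :: "'a set"
  proof (rule finite_subset)
    show "pairings S \<subseteq> {p. p permutes S}"
      by (auto intro: pairings_permutes)
    show "finite {p. p permutes S}" using that by (rule finite_permutations)
  qed
  have "(\<Sum>y\<in>T. \<Sum>q\<in>pairings (T - {y}). F (q(x := y, y := x))) =
      (\<Sum>(y, q)\<in>(SIGMA y:T. pairings (T - {y})). F (q(x := y, y := x)))"
    using assms(1) fin by (intro sum.Sigma) auto
  also have "\<dots> = (\<Sum>p\<in>pairings (insert x T). F p)"
  proof (rule sum.reindex_bij_witness[of _
      "\<lambda>p. (p x, p(x := x, p x := p x))" "\<lambda>(y, q). q(x := y, y := x)"], goal_cases)
    case (1 yq)
    then obtain y q where yq: "yq = (y, q)" "y \<in> T" and q: "q \<in> pairings (T - {y})" by auto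
    have "q x = x" "q y = y" using q assms(2) by (auto simp: pairings_def)
    then show ?case using yq assms(2) by (auto simp: fun_eq_iff)
  next
    case (2 yq)
    then obtain y q where yq: "yq = (y, q)" "y \<in> T" and q: "q \<in> pairings (T - {y})" by auto
    have "q k \<in> T \<and> q k \<noteq> y \<and> q k \<noteq> k \<and> q (q k) = k" if "k \<in> T" "k \<noteq> y" for k
      using q that by (auto simp: pairings_def)
    moreover have "q k = k" if "k \<notin> T" for k
      using q that by (auto simp: pairings_def)
    ultimately show ?case
      using yq assms(2) by (auto simp: pairings_def)
  next
    case (3 p)
    have "p (p x) = x" using 3 by (rule pairings_involution)
    then show ?case by (auto simp: fun_eq_iff)
  next
    case (4 p)
    have p: "p k \<in> insert x T" "p k \<noteq> k" if "k \<in> insert x T" for k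
      using 4 that by (auto simp: pairings_def)
    have pp: "p (p k) = k" for k using 4 by (rule pairings_involution)
    have out: "p k = k" if "k \<notin> insert x T" for k
      using 4 that by (auto simp: pairings_def)
    define q where "q = p(x := x, p x := p x)"
    have "q k = k" if "k \<notin> T - {p x}" for k
      using out[of k] that by (auto simp: q_def)
    moreover have "q k \<in> T - {p x} \<and> q k \<noteq> k \<and> q (q k) = k" if k: "k \<in> T - {p x}" for k
    proof -
      have "k \<noteq> x" "k \<noteq> p x" "k \<in> insert x T" using k assms(2) by auto
      moreover have "p k \<noteq> x" "p k \<noteq> p x"
        using pp[of k] pp[of x] \<open>k \<noteq> x\<close> \<open>k \<noteq> p x\<close> by metis+
      ultimately show ?thesis using p[of k] pp[of k] by (simp add: q_def)
    qed
    ultimately have "q \<in> pairings (T - {p x})" by (simp add: pairings_def)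
    moreover have "p x \<in> T" using p[of x] by auto
    ultimately show ?case by (simp add: q_def)
  qed auto
  finally show ?thesis by simp
qed

text \<open>Unrolling the recursion, always contracting the least remaining element, produces every pairing
exactly once, each pair being met at its smaller element.\<close>

lemma pairing_expansion:
  fixes S :: "'a::linorder set" and V :: "'a set \<Rightarrow> 'b::comm_semiring_1"
  assumes "finite S" and V0: "V {} = 1"
    and V: "\<And>x T. finite T \<Longrightarrow> x \<notin> T \<Longrightarrow> insert x T \<subseteq> S \<Longrightarrow> V (insert x T) = (\<Sum>y\<in>T. K x y * V (T - {y}))"
  shows "V S = (\<Sum>p\<in>pairings S. \<Prod>k\<in>{k\<in>S. k < p k}. K k (p k))"
proof -
  have "V U = (\<Sum>p\<in>pairings U. \<Prod>k\<in>{k\<in>U. k < p k}. K k (p k))" if "finite U" "U \<subseteq> S" for U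
    using that
  proof (induction U rule: finite_psubset_induct)
    case (psubset U)
    show ?case
    proof (cases "U = {}")
      case True
      have "pairings {} = {id :: 'a \<Rightarrow> 'a}" by (auto simp: pairings_def)
      then show ?thesis by (simp add: True V0)
    next
      case False
      define x where "x = Min U"
      define T where "T = U - {x}"
      have x: "x \<in> U" "\<And>y. y \<in> U \<Longrightarrow> x \<le> y"
        using False psubset.hyps by (auto simp: x_def)
      then have U: "U = insert x T" "x \<notin> T" "finite T"
        using psubset.hyps by (auto simp: T_def)
      have lt: "x < y" if "y \<in> T" for y
        using that x(2)[of y] by (auto simp: T_def)
      have "V U = (\<Sum>y\<in>T. K x y * V (T - {y}))"
        using V[OF U(3,2)] U(1) psubset.prems by simp
      also have "\<dots> = (\<Sum>y\<in>T. \<Sum>q\<in>pairings (T - {y}).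
          \<Prod>k\<in>{k\<in>U. k < (q(x := y, y := x)) k}. K k ((q(x := y, y := x)) k))"
      proof (rule sum.cong[OF refl])
        fix y assume y: "y \<in> T"
        have "T - {y} \<subset> U" "T - {y} \<subseteq> S" using U(1,2) psubset.prems by auto
        then have "K x y * V (T - {y}) =
            (\<Sum>q\<in>pairings (T - {y}). K x y * (\<Prod>k\<in>{k\<in>T - {y}. k < q k}. K k (q k)))"
          by (simp add: psubset.IH sum_distrib_left)
        also have "\<dots> = (\<Sum>q\<in>pairings (T - {y}).
          \<Prod>k\<in>{k\<in>U. k < (q(x := y, y := x)) k}. K k ((q(x := y, y := x)) k))"
        proof (rule sum.cong[OF refl])
          fix q assume "q \<in> pairings (T - {y})"
          define p where "p = q(x := y, y := x)"
          have "{k\<in>U. k < p k} = insert x {k\<in>T - {y}. k < q k}"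
            using U(1,2) y lt[OF y] less_asym[OF lt[OF y]] by (auto simp: p_def split: if_splits)
          moreover have "(\<Prod>k\<in>insert x {k\<in>T - {y}. k < q k}. K k (p k)) =
              K x y * (\<Prod>k\<in>{k\<in>T - {y}. k < q k}. K k (q k))"
            using U(2,3) y by (subst prod.insert) (auto simp: p_def intro!: arg_cong2[where f = "(*)"] prod.cong)
          ultimately show "K x y * (\<Prod>k\<in>{k\<in>T - {y}. k < q k}. K k (q k)) = (\<Prod>k\<in>{k\<in>U. k < p k}. K k (p k))"
            by simp
        qed
        finally show "K x y * V (T - {y}) = (\<Sum>q\<in>pairings (T - {y}).
          \<Prod>k\<in>{k\<in>U. k < (q(x := y, y := x)) k}. K k ((q(x := y, y := x)) k))" .
      qed
      also have "\<dots> = (\<Sum>p\<in>pairings U. \<Prod>k\<in>{k\<in>U. k < p k}. K k (p k))"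
        unfolding U(1) by (rule sum_pairings_insert[OF U(3,2), symmetric])
      finally show ?thesis .
    qed
  qed
  then show ?thesis using assms(1) by simp
qed

text \<open>Listing a pair by its smaller element is an artefact of the recursion. For the sets \<open>FD\<close> the
product has to be taken over another system of representatives.\<close>

lemma prod_pairing_transversal:
  fixes S :: "'a::linorder set"
  assumes p: "p \<in> pairings S" and F: "F \<subseteq> S" "\<And>k. k \<in> S \<Longrightarrow> p k \<in> F \<longleftrightarrow> k \<notin> F"
    and sym: "\<And>k. k \<in> S \<Longrightarrow> K (p k) k = K k (p k)"
  shows "(\<Prod>k\<in>{k\<in>S. k < p k}. K k (p k)) = (\<Prod>k\<in>F. K k (p k))"
proof -
  have p': "p k \<in> S" "p (p k) = k" "p k \<noteq> k" if "k \<in> S" for k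
    using p that by (auto simp: pairings_def)
  show ?thesis
  proof (rule prod.reindex_bij_witness[of _ "\<lambda>k. if k < p k then k else p k" "\<lambda>k. if k \<in> F then k else p k"],
      goal_cases)
    case (1 k)
    then show ?case using p'[of k] F(2)[of k] by auto
  next
    case (2 k)
    then show ?case using p'[of k] F(2)[of k] by auto
  next
    case (3 k)
    then have "k \<in> S" using F(1) by auto
    then show ?case using 3 p'[of k] F(2)[of k] by auto
  next
    case (4 k)
    then have "k \<in> S" using F(1) by auto
    then show ?case using 4 p'[of k] by (auto simp: not_less order.order_iff_strict)
  next
    case (5 k)
    then show ?case using p'[of k] sym[of k] by auto
  qed
qed

section \<open>Wick formula for quaternionic Gaussian matrices\<close>

text \<open>The covariance, without conjugation, of two entries of the representing matrices, where
\<open>(a, b, r, c)\<close> stands for entry \<open>(r, c)\<close> of the quaternion in position \<open>(a, b)\<close>.\<close>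

definition entry_cov :: "('a \<times> 'b \<times> int \<times> int) \<Rightarrow> ('a \<times> 'b \<times> int \<times> int) \<Rightarrow> complex" where
  "entry_cov = (\<lambda>(a, b, r, c) (a', b', r', c').
    if a' = a \<and> b' = b \<and> r' = - r \<and> c' = - c then of_int (r * c) / 2 else 0)"

text \<open>The index set \<open>C\<close> in the proof lists all real coordinates of the matrix. A linear form \<open>A j\<close> lives
on the four coordinates of one matrix entry, so the general covariance of two linear forms
collapses to \<open>sum_entry_coeff_mult\<close>.\<close>

lemma quat_gaussian_matrix_wick:
  fixes G :: "'w \<Rightarrow> quat^'n^'m" and S :: "'j::linorder set"
  assumes P: "prob_space P" and G: "quat_gaussian_matrix P G" and S: "finite S"
    and rc: "\<And>j. j \<in> S \<Longrightarrow> r j \<in> {1, -1}" "\<And>j. j \<in> S \<Longrightarrow> c j \<in> {1, -1}"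
  shows "has_bochner_integral P (\<lambda>w. \<Prod>j\<in>S. quat_entry (G w $ a j $ b j) (r j) (c j))
    (\<Sum>p\<in>pairings S. \<Prod>k\<in>{k\<in>S. k < p k}.
      entry_cov (a k, b k, r k, c k) (a (p k), b (p k), r (p k), c (p k)))"
proof -
  define C :: "('m \<times> 'n \<times> nat) set" where "C = UNIV \<times> UNIV \<times> {..<4}"
  define X where "X = (\<lambda>(x :: 'm, y :: 'n, t) w. coord t (G w $ x $ y))"
  define A where "A = (\<lambda>j (x, y, t). if x = a j \<and> y = b j then entry_coeff (r j) (c j) t else 0)"
  have C: "finite C" by (simp add: C_def)
  have sum_C: "(\<Sum>x\<in>C. if fst x = a j \<and> fst (snd x) = b j then F x else 0) = (\<Sum>t<4. F (a j, b j, t))"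
    for j and F :: "_ \<Rightarrow> complex"
  proof -
    have "(\<Sum>x\<in>C. if fst x = a j \<and> fst (snd x) = b j then F x else 0) =
        (\<Sum>x\<in>{x\<in>C. fst x = a j \<and> fst (snd x) = b j}. F x)"
      using C by (rule sum.inter_filter[symmetric])
    also have "{x\<in>C. fst x = a j \<and> fst (snd x) = b j} = (\<lambda>t. (a j, b j, t)) ` {..<4}"
      by (auto simp: C_def)
    also have "(\<Sum>x\<in>\<dots>. F x) = (\<Sum>t<4. F (a j, b j, t))"
      by (subst sum.reindex) (auto simp: inj_on_def)
    finally show ?thesis .
  qed
  have entry: "quat_entry (G w $ a j $ b j) (r j) (c j) = (\<Sum>x\<in>C. A j x * of_real (X x w))" for j w
  proof -
    have "(\<Sum>x\<in>C. A j x * of_real (X x w)) = (\<Sum>x\<in>C. if fst x = a j \<and> fst (snd x) = b j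
        then entry_coeff (r j) (c j) (snd (snd x)) * of_real (X x w) else 0)"
      by (intro sum.cong refl) (auto simp: A_def)
    then show ?thesis
      unfolding sum_C by (simp add: quat_entry_eq_sum_coord X_def)
  qed
  have cov: "of_real (1/4) * (\<Sum>x\<in>C. A j x * A l x) =
      entry_cov (a j, b j, r j, c j) (a l, b l, r l, c l)" if j: "j \<in> S" and l: "l \<in> S" for j l
  proof -
    have "(\<Sum>x\<in>C. A j x * A l x) = (\<Sum>x\<in>C. if fst x = a j \<and> fst (snd x) = b j
        then (if a l = a j \<and> b l = b j then entry_coeff (r j) (c j) (snd (snd x)) *
          entry_coeff (r l) (c l) (snd (snd x)) else 0) else 0)"
      by (intro sum.cong refl) (auto simp: A_def)
    also have "\<dots> = (\<Sum>t<4. if a l = a j \<and> b l = b j then entry_coeff (r j) (c j) t *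
          entry_coeff (r l) (c l) t else 0)"
      unfolding sum_C by (simp only: fst_conv snd_conv)
    also have "\<dots> = (if a l = a j \<and> b l = b j then
        (if r l = - r j \<and> c l = - c j then 2 * of_int (r j * c j) else 0) else 0)"
      using sum_entry_coeff_mult[OF rc rc, OF j j l l] by (cases "a l = a j \<and> b l = b j"; simp only: if_True if_False sum.neutral_const simp_thms)
    finally show ?thesis by (simp add: entry_cov_def)
  qed
  have "has_bochner_integral P (\<lambda>w. \<Prod>x\<in>C. X x w ^ m x) (\<Prod>x\<in>C. gauss_moment (1/4) (m x))" for m
    using quat_gaussian_matrix_moments[OF P G, of m] by (simp add: C_def X_def case_prod_beta')
  from has_bochner_integral_linear_forms[OF C S this, of A]
  have "has_bochner_integral P (\<lambda>w. \<Prod>j\<in>S. quat_entry (G w $ a j $ b j) (r j) (c j))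
      (linear_forms_moment (1/4) C A S)"
    by (simp add: entry)
  also have "linear_forms_moment (1/4) C A S = (\<Sum>p\<in>pairings S. \<Prod>k\<in>{k\<in>S. k < p k}.
      entry_cov (a k, b k, r k, c k) (a (p k), b (p k), r (p k), c (p k)))"
  proof (rule pairing_expansion[OF S])
    show "linear_forms_moment (1/4) C A {} = 1" by (simp add: linear_forms_moment_def)
    show "linear_forms_moment (1/4) C A (insert x T) = (\<Sum>y\<in>T. entry_cov (a x, b x, r x, c x)
        (a y, b y, r y, c y) * linear_forms_moment (1/4) C A (T - {y}))"
      if "finite T" "x \<notin> T" "insert x T \<subseteq> S" for x T
      unfolding linear_forms_moment_insert[OF C that(1,2)]
      using that(3) by (intro sum.cong refl arg_cong2[where f = "(*)"] cov) auto
  qed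
  finally show ?thesis .
qed

section \<open>Permutations and pairings of signed integers\<close>

lemma finite_pmset [simp]: "finite (pmset n)"
  by (simp add: pmset_def)

lemma uminus_in_pmset_iff [simp]: "- k \<in> pmset n \<longleftrightarrow> k \<in> pmset n"
  by (auto simp: pmset_def)

lemma zero_notin_pmset [simp]: "0 \<notin> pmset n"
  by (auto simp: pmset_def)

lemma prod_pmset:
  fixes g :: "int \<Rightarrow> 'a::comm_monoid_mult"
  shows "(\<Prod>k\<in>pmset n. g k) = (\<Prod>k\<in>{1..int n}. g k * g (- k))"
proof -
  have "(\<Prod>k\<in>pmset n. g k) = (\<Prod>k\<in>{1..int n}. g k) * (\<Prod>k\<in>uminus ` {1..int n}. g k)"
    unfolding pmset_def by (rule prod.union_disjoint) auto
  also have "(\<Prod>k\<in>uminus ` {1..int n}. g k) = (\<Prod>k\<in>{1..int n}. g (- k))"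
    by (subst prod.reindex) (auto simp only: inj_on_def o_def minus_equation_iff neg_equal_iff_equal)
  finally show ?thesis
    by (simp only: prod.distrib)
qed

lemma PM_permutes: "\<alpha> \<in> PM n \<Longrightarrow> \<alpha> permutes pmset n"
  by (simp add: PM_def)

lemma PM_permutation: "\<alpha> \<in> PM n \<Longrightarrow> permutation \<alpha>"
  using PM_permutes permutation_permutes finite_pmset by blast

lemma PM_in_pmset_iff [simp]: "\<alpha> \<in> PM n \<Longrightarrow> \<alpha> k \<in> pmset n \<longleftrightarrow> k \<in> pmset n"
  by (simp add: PM_permutes permutes_in_image)

lemma PM_inv: "\<alpha> \<in> PM n \<Longrightarrow> inv \<alpha> k = - \<alpha> (- k)"
  by (auto simp: PM_def fun_eq_iff dest: spec[of _ k])

lemma PM_uminus: "\<alpha> \<in> PM n \<Longrightarrow> \<alpha> (- \<alpha> k) = - k"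
  using PM_inv[of \<alpha> n "\<alpha> k"] permutes_inverses(2)[OF PM_permutes, of \<alpha> n k] by simp

lemma PM_uminus_notin_orbit: "\<alpha> \<in> PM n \<Longrightarrow> k \<in> pmset n \<Longrightarrow> - k \<notin> orbit \<alpha> k"
  by (simp add: PM_def)

text \<open>The map \<open>p \<mapsto> \<delta>p\<close>, cut off outside \<open>pmset n\<close> because \<open>PM n\<close> and \<open>pairings\<close> both consist
of functions that are the identity there. On these sets it is its own inverse, and it exchanges them:
\<open>\<delta>\<alpha>\<delta> = \<alpha>\<inverse>\<close> says that \<open>\<delta>\<alpha>\<close> is an involution.\<close>

definition negate_on :: "nat \<Rightarrow> (int \<Rightarrow> int) \<Rightarrow> int \<Rightarrow> int" where
  "negate_on n p = (\<lambda>k. if k \<in> pmset n then - p k else k)"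

lemma negate_on_PM: 
  assumes "\<alpha> \<in> PM n"
  shows "negate_on n \<alpha> \<in> pairings (pmset n)"
proof -
  have "- \<alpha> k \<noteq> k" if "k \<in> pmset n" for k
    using PM_uminus_notin_orbit[OF assms that] orbit.base[of \<alpha> k] by (metis minus_minus)
  then show ?thesis
    using assms by (auto simp: pairings_def negate_on_def PM_uminus)
qed

text \<open>That no cycle of \<open>\<alpha>\<close> contains both \<open>k\<close> and \<open>-k\<close> follows from \<open>\<delta>\<alpha>\<close> having no fixed
point. If \<open>\<alpha>\<^sup>m k = -k\<close> with \<open>m \<ge> 2\<close>, then \<open>\<alpha>\<^sup>m\<^sup>-\<^sup>2 (\<alpha> k) = -\<alpha> k\<close>, as
\<open>\<alpha> (-\<alpha> k) = -k\<close>; this descends to \<open>m = 0\<close> or \<open>m = 1\<close>, both impossible.\<close>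

lemma negate_on_pairings:
  assumes p: "p \<in> pairings (pmset n)"
  shows "negate_on n p \<in> PM n"
proof -
  define \<alpha> where "\<alpha> = negate_on n p"
  have p': "p k \<in> pmset n" "p k \<noteq> k" if "k \<in> pmset n" for k
    using p that by (auto simp: pairings_def)
  have pp: "p (p k) = k" for k using p by (rule pairings_involution)
  have in_S: "\<alpha> k = - p k" if "k \<in> pmset n" for k
    using that by (simp add: \<alpha>_def negate_on_def)
  have out_S: "\<alpha> k = k" if "k \<notin> pmset n" for k
    using that by (simp add: \<alpha>_def negate_on_def)
  have l: "- \<alpha> (- \<alpha> k) = k" for k
    by (cases "k \<in> pmset n") (simp_all add: in_S out_S p' pp)
  have r: "\<alpha> (- \<alpha> (- k)) = k" for k
    using l[of "- k"] by simp
  have inv: "inv \<alpha> = uminus \<circ> \<alpha> \<circ> uminus"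
    by (rule inv_unique_comp) (simp_all add: fun_eq_iff l r)
  have perm: "\<alpha> permutes pmset n"
    unfolding permutes_def
  proof (intro conjI allI impI)
    show "\<exists>!x. \<alpha> x = y" for y
      using l r by metis
  qed (simp add: out_S)
  have notin: "(\<alpha> ^^ m) k \<noteq> - k" if "k \<in> pmset n" for m k
    using that
  proof (induction m arbitrary: k rule: induct_nat_012)
    case 0
    then show ?case using zero_notin_pmset[of n] by (auto simp: pmset_def)
  next
    case 1
    then show ?case using p' by (simp add: in_S)
  next
    case (ge2 m)
    show ?case
    proof
      assume eq: "(\<alpha> ^^ Suc (Suc m)) k = - k"
      have "\<alpha> ((\<alpha> ^^ m) (\<alpha> k)) = \<alpha> (- \<alpha> k)"
        using eq l[of k] by (simp add: funpow_swap1)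
      then have "(\<alpha> ^^ m) (\<alpha> k) = - \<alpha> k"
        using permutes_inj[OF perm] by (simp add: inj_eq)
      moreover have "\<alpha> k \<in> pmset n" using ge2.prems p' by (simp add: in_S)
      ultimately show False using ge2.IH(1) by blast
    qed
  qed
  have "- k \<notin> orbit \<alpha> k" if "k \<in> pmset n" for k
    using notin[OF that] unfolding orbit_altdef by auto metis
  then show ?thesis
    using perm inv by (simp add: PM_def \<alpha>_def)
qed

lemma sum_pairings_pmset:
  fixes F :: "(int \<Rightarrow> int) \<Rightarrow> 'a::comm_monoid_add"
  shows "(\<Sum>p\<in>pairings (pmset n). F p) = (\<Sum>\<alpha>\<in>PM n. F (negate_on n \<alpha>))"
proof (rule sum.reindex_bij_witness[of _ "negate_on n" "negate_on n"], goal_cases)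
  case (1 p)
  then show ?case by (auto simp: fun_eq_iff negate_on_def pairings_def)
next
  case (2 p)
  then show ?case by (rule negate_on_pairings)
next
  case (3 \<alpha>)
  then show ?case by (auto simp: fun_eq_iff negate_on_def PM_def permutes_def)
next
  case (4 \<alpha>)
  then show ?case by (rule negate_on_PM)
next
  case (5 p)
  have "negate_on n (negate_on n p) = p"
    using 5 by (auto simp: fun_eq_iff negate_on_def pairings_def)
  then show ?case by simp
qed

section \<open>One cycle from each pair of cycles\<close>

lemma PM_orbit_uminus:
  assumes "\<alpha> \<in> PM n"
  shows "orbit \<alpha> (- k) = uminus ` orbit \<alpha> k"
proof -
  have "uminus ` orbit \<alpha> k = orbit (inv \<alpha>) (- k)"
    using permutation_self_in_orbit[OF PM_permutation[OF assms]]
    by (rule orbit_inverse) (simp add: PM_inv[OF assms])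
  then show ?thesis
    using orbit_inv_eq[OF PM_permutation[OF assms]] by simp
qed

lemma PM_orbit_cong:
  assumes "\<alpha> \<in> PM n" "m \<in> orbit \<alpha> k"
  shows "orbit \<alpha> m = orbit \<alpha> k"
  using orbit_cyclic_eq3[OF cyclic_on_orbit'[OF PM_permutation[OF assms(1)]] assms(2)] .

lemma FD_subset: "FD n \<alpha> \<subseteq> pmset n"
  by (auto simp: FD_def)

lemma FD_cong_orbit:
  "k \<in> pmset n \<Longrightarrow> l \<in> pmset n \<Longrightarrow> orbit \<alpha> k = orbit \<alpha> l \<Longrightarrow> k \<in> FD n \<alpha> \<longleftrightarrow> l \<in> FD n \<alpha>"
  by (simp add: FD_def)

lemma PM_in_FD_iff:
  assumes "\<alpha> \<in> PM n" "k \<in> pmset n"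
  shows "\<alpha> k \<in> FD n \<alpha> \<longleftrightarrow> k \<in> FD n \<alpha>"
  using assms by (intro FD_cong_orbit permutation_orbit_step PM_permutation[of _ n]) auto

text \<open>An element \<open>m\<close> of smallest absolute value is unique in its cycle, since \<open>-m\<close> lies in another one;
so its sign alone decides membership in \<open>FD\<close>.\<close>

lemma in_FD_iff_pos:
  assumes \<alpha>: "\<alpha> \<in> PM n" and k: "k \<in> pmset n"
    and m: "m \<in> orbit \<alpha> k" "\<And>l. l \<in> orbit \<alpha> k \<Longrightarrow> \<bar>m\<bar> \<le> \<bar>l\<bar>"
  shows "k \<in> FD n \<alpha> \<longleftrightarrow> m > 0"
proof
  assume "k \<in> FD n \<alpha>"
  then obtain m' where m': "m' \<in> orbit \<alpha> k" "0 < m'" "\<And>l. l \<in> orbit \<alpha> k \<Longrightarrow> \<bar>m'\<bar> \<le> \<bar>l\<bar>"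
    by (auto simp: FD_def)
  have "m' \<in> pmset n"
    using m'(1) permutes_orbit_subset[OF PM_permutes[OF \<alpha>] k] by blast
  then have "- m' \<notin> orbit \<alpha> k"
    using PM_uminus_notin_orbit[OF \<alpha>] PM_orbit_cong[OF \<alpha> m'(1)] by metis
  moreover have "\<bar>m\<bar> = \<bar>m'\<bar>"
    using m(2)[OF m'(1)] m'(3)[OF m(1)] by simp
  ultimately show "m > 0"
    using m(1) m'(2) by (cases "m > 0") auto
qed (use k m in \<open>auto simp: FD_def\<close>)

text \<open>The cycle of \<open>-k\<close> is the negative of the cycle of \<open>k\<close>, and its element of smallest absolute value
has the opposite sign.\<close>

lemma FD_uminus:
  assumes \<alpha>: "\<alpha> \<in> PM n" and k: "k \<in> pmset n"
  shows "- k \<in> FD n \<alpha> \<longleftrightarrow> k \<notin> FD n \<alpha>"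
proof -
  have sub: "orbit \<alpha> k \<subseteq> pmset n"
    using permutes_orbit_subset[OF PM_permutes[OF \<alpha>] k] .
  then have "finite (orbit \<alpha> k)" using finite_subset finite_pmset by blast
  then obtain m where m: "m \<in> orbit \<alpha> k" "\<And>l. l \<in> orbit \<alpha> k \<Longrightarrow> \<bar>m\<bar> \<le> \<bar>l\<bar>"
    using arg_min_if_finite(1)[of "orbit \<alpha> k" abs] arg_min_least[of "orbit \<alpha> k" _ abs] orbit_nonempty
    by metis
  have "- k \<in> FD n \<alpha> \<longleftrightarrow> - m > 0"
    using k m by (intro in_FD_iff_pos[OF \<alpha>]) (auto simp: PM_orbit_uminus[OF \<alpha>])
  moreover have "k \<in> FD n \<alpha> \<longleftrightarrow> m > 0"
    using m by (intro in_FD_iff_pos[OF \<alpha> k])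
  moreover have "m \<noteq> 0" using m(1) sub by auto
  ultimately show ?thesis by auto
qed

lemma FD_inv: "\<alpha> \<in> PM n \<Longrightarrow> FD n (inv \<alpha>) = FD n \<alpha>"
  by (simp add: FD_def orbit_inv_eq PM_permutation)

lemma num_orbits_inv: "\<alpha> \<in> PM n \<Longrightarrow> num_orbits (inv \<alpha>) S = num_orbits \<alpha> S"
  by (simp add: num_orbits_def orbit_inv_eq PM_permutation)

lemma num_orbits_pmset:
  assumes \<alpha>: "\<alpha> \<in> PM n"
  shows "num_orbits \<alpha> (pmset n) = 2 * num_orbits \<alpha> (FD n \<alpha>)"
proof -
  have S: "pmset n = FD n \<alpha> \<union> uminus ` FD n \<alpha>"
    using FD_uminus[OF \<alpha>] FD_subset[of n \<alpha>] by (auto simp: image_iff) (metis minus_minus)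
  have eq: "orbit \<alpha> ` uminus ` FD n \<alpha> = (`) uminus ` orbit \<alpha> ` FD n \<alpha>"
    unfolding image_image by (simp add: PM_orbit_uminus[OF \<alpha>])
  have fin: "finite (FD n \<alpha>)" using finite_subset[OF FD_subset finite_pmset] .
  have "inj_on ((`) uminus) (orbit \<alpha> ` FD n \<alpha>)"
    by (auto intro!: inj_onI simp: inj_image_eq_iff)
  then have "card (orbit \<alpha> ` uminus ` FD n \<alpha>) = card (orbit \<alpha> ` FD n \<alpha>)"
    unfolding eq by (rule card_image)
  moreover have "orbit \<alpha> ` FD n \<alpha> \<inter> orbit \<alpha> ` uminus ` FD n \<alpha> = {}"
  proof (rule ccontr)
    assume "\<not> ?thesis"
    then obtain k l where kl: "k \<in> FD n \<alpha>" "l \<in> FD n \<alpha>" "orbit \<alpha> k = orbit \<alpha> (- l)"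
      by auto
    then have "- l \<in> FD n \<alpha>"
      using FD_cong_orbit[of k n "- l" \<alpha>] FD_subset[of n \<alpha>] by auto
    then show False using kl(2) FD_uminus[OF \<alpha>, of l] FD_subset[of n \<alpha>] by auto
  qed
  ultimately show ?thesis
    unfolding num_orbits_def S image_Un using fin
    by (subst card_Un_disjoint) (simp_all add: S[symmetric])
qed

text \<open>Exactly one of \<open>k\<close> and \<open>-k\<close> lies in \<open>FD\<close>. Products over \<open>FD\<close> and over \<open>{1..n}\<close> can thus be
compared factor by factor.\<close>

lemma prod_FD:
  fixes g :: "int \<Rightarrow> 'a::comm_monoid_mult"
  assumes \<alpha>: "\<alpha> \<in> PM n"
  shows "(\<Prod>k\<in>FD n \<alpha>. g k) = (\<Prod>k\<in>{1..int n}. if k \<in> FD n \<alpha> then g k else g (- k))"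
proof (rule prod.reindex_bij_witness[of _ "\<lambda>k. if k \<in> FD n \<alpha> then k else - k" abs], goal_cases)
  case (1 k)
  then have "k \<in> pmset n" using FD_subset by auto
  then show ?case using 1 FD_uminus[OF \<alpha>, of k] by (auto simp: abs_if)
next
  case (2 k)
  then show ?case using FD_subset[of n \<alpha>] by (auto simp: pmset_def)
next
  case (3 k)
  then show ?case by auto
next
  case (4 k)
  then have "k \<in> pmset n" by (auto simp: pmset_def)
  then show ?case using FD_uminus[OF \<alpha>, of k] by auto
next
  case (5 k)
  then have "k \<in> pmset n" using FD_subset by auto
  then show ?case using 5 FD_uminus[OF \<alpha>, of k] by (auto simp: abs_if)
qed

lemma PM_sign_condition_uminus:
  fixes \<alpha> :: "int \<Rightarrow> int"
  assumes \<alpha>: "\<alpha> \<in> PM n" and "k \<in> pmset n"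
  shows "sgn (- \<alpha> k) * x (- \<alpha> k) = sgn (\<alpha> (- \<alpha> k)) * x (- \<alpha> (- \<alpha> k)) \<longleftrightarrow>
    sgn k * x k = sgn (\<alpha> k) * (x (- \<alpha> k) :: int)"
  by (auto simp: PM_uminus[OF \<alpha>] sgn_minus)

text \<open>The set \<open>FD\<close> contains one element of each pair \<open>{k, -\<alpha> k}\<close>, so a condition that is symmetric in
the pair needs to be tested there only.\<close>

lemma PM_all_FD_iff:
  assumes \<alpha>: "\<alpha> \<in> PM n" and Q: "\<And>k. k \<in> pmset n \<Longrightarrow> Q (- \<alpha> k) \<longleftrightarrow> Q k"
  shows "(\<forall>k\<in>FD n \<alpha>. Q k) \<longleftrightarrow> (\<forall>k\<in>pmset n. Q k)"
proof
  assume F: "\<forall>k\<in>FD n \<alpha>. Q k"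
  show "\<forall>k\<in>pmset n. Q k"
  proof
    fix k assume k: "k \<in> pmset n"
    show "Q k"
    proof (cases "k \<in> FD n \<alpha>")
      case False
      then have "- \<alpha> k \<in> FD n \<alpha>"
        using FD_uminus[OF \<alpha>, of "\<alpha> k"] PM_in_FD_iff[OF \<alpha> k] k \<alpha> by simp
      then show ?thesis using F Q[OF k] by auto
    qed (use F in auto)
  qed
qed (use FD_subset in blast)

lemma prod_if_zero:
  fixes g :: "'a \<Rightarrow> 'b::comm_semiring_1"
  assumes "finite F"
  shows "(\<Prod>k\<in>F. if Q k then g k else 0) = (if \<forall>k\<in>F. Q k then \<Prod>k\<in>F. g k else 0)"
  using assms by induction auto

section \<open>Expansion of the Wishart entries\<close>

text \<open>The pair \<open>y\<close> consists of the index summed over between \<open>G\<^sup>*\<close> and \<open>D\<close> in the product of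
quaternionic matrices and of the accompanying index \<open>1\<close> or \<open>-1\<close> of the representing matrices; \<open>z\<close>
plays the same part between \<open>D\<close> and \<open>G\<close>. By \<open>quat_entry_qcnj\<close>
the factor from \<open>G\<^sup>*\<close> is rewritten as one from \<open>G\<close>, which is all that the Wick formula handles.\<close>

lemma wishart_entry:
  fixes M :: "quat^'n^'m"
  assumes "r \<in> {1, -1}" "c \<in> {1, -1}"
  shows "quat_entry (wishart M D $ a $ b) r c =
    (\<Sum>y\<in>UNIV \<times> {1, -1}. \<Sum>z\<in>UNIV \<times> {1, -1}.
      of_int (r * snd y) * quat_entry (D $ fst y $ fst z) (snd y) (snd z) / of_nat CARD('n) *
      (quat_entry (M $ fst y $ a) (- snd y) (- r) * quat_entry (M $ fst z $ b) (snd z) c))"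
proof -
  have "quat_entry (wishart M D $ a $ b) r c =
      (\<Sum>v\<in>UNIV. \<Sum>u\<in>UNIV. quat_entry (qcnj (M $ u $ a) * (D $ u $ v) * (M $ v $ b)) r c) / of_nat CARD('n)"
    by (simp add: wishart_def conj_transpose_def matrix_matrix_mult_def quat_entry_scaleR
      quat_entry_sum sum_distrib_right)
  also have "\<dots> = (\<Sum>u\<in>UNIV. \<Sum>v\<in>UNIV. quat_entry (qcnj (M $ u $ a) * (D $ u $ v) * (M $ v $ b)) r c) / of_nat CARD('n)"
    by (subst sum.swap) (rule refl)
  also have "\<dots> = (\<Sum>u\<in>UNIV. \<Sum>v\<in>UNIV. \<Sum>g\<in>{1, -1}. \<Sum>h\<in>{1, -1}.
      of_int (r * h) * quat_entry (D $ u $ v) h g / of_nat CARD('n) *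
      (quat_entry (M $ u $ a) (- h) (- r) * quat_entry (M $ v $ b) g c))"
  proof -
    have "quat_entry (qcnj q * d * s) r c / N = (\<Sum>g\<in>{1, -1}. \<Sum>h\<in>{1, -1}.
        of_int (r * h) * quat_entry d h g / N * (quat_entry q (- h) (- r) * quat_entry s g c))"
      for q d s :: quat and N
    proof -
      have "quat_entry (qcnj q * d * s) r c = (\<Sum>g\<in>{1, -1}. quat_entry (qcnj q * d) r g * quat_entry s g c)"
        by (rule quat_entry_mult[OF assms])
      also have "\<dots> = (\<Sum>g\<in>{1, -1}. (\<Sum>h\<in>{1, -1}. quat_entry (qcnj q) r h * quat_entry d h g) * quat_entry s g c)"
        by (intro sum.cong refl arg_cong2[where f = "(*)"] quat_entry_mult assms(1))
      also have "\<dots> = (\<Sum>g\<in>{1, -1}. \<Sum>h\<in>{1, -1}.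
        of_int (r * h) * quat_entry d h g * (quat_entry q (- h) (- r) * quat_entry s g c))"
        unfolding sum_distrib_right
        by (intro sum.cong refl) (simp add: quat_entry_qcnj[OF assms(1)])
      finally show ?thesis by (simp add: add_divide_distrib diff_divide_distrib)
    qed
    then show ?thesis by (simp only: sum_divide_distrib)
  qed
  also have "\<dots> = (\<Sum>u\<in>UNIV. \<Sum>h\<in>{1, -1}. \<Sum>v\<in>UNIV. \<Sum>g\<in>{1, -1}.
      of_int (r * h) * quat_entry (D $ u $ v) h g / of_nat CARD('n) *
      (quat_entry (M $ u $ a) (- h) (- r) * quat_entry (M $ v $ b) g c))"
    by (rule sum.cong[OF refl], subst sum.swap[of _ "{1, -1}" "{1, -1}"], rule sum.swap)
  finally show ?thesis
    by (simp only: sum.cartesian_product' fst_conv snd_conv)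
qed

text \<open>The left index of the \<open>k\<close>-th factor is recorded at \<open>k\<close> and the right one at \<open>-k\<close>, which is what
makes \<open>pmset n\<close> the natural index set for the \<open>2n\<close> occurrences of \<open>G\<close>.\<close>

lemma prod_sum_sum_pmset:
  fixes g :: "int \<Rightarrow> 'a \<Rightarrow> 'a \<Rightarrow> 'b::comm_semiring_1"
  assumes A: "finite A"
  shows "(\<Prod>k\<in>{1..int n}. \<Sum>y\<in>A. \<Sum>z\<in>A. g k y z) =
    (\<Sum>x\<in>pmset n \<rightarrow>\<^sub>E A. \<Prod>k\<in>{1..int n}. g k (x k) (x (- k)))"
proof -
  have "(\<Prod>k\<in>{1..int n}. \<Sum>y\<in>A. \<Sum>z\<in>A. g k y z) =
      (\<Prod>k\<in>{1..int n}. \<Sum>yz\<in>A \<times> A. g k (fst yz) (snd yz))"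
    by (simp only: sum.cartesian_product' fst_conv snd_conv)
  also have "\<dots> = (\<Sum>c\<in>{1..int n} \<rightarrow>\<^sub>E A \<times> A. \<Prod>k\<in>{1..int n}. g k (fst (c k)) (snd (c k)))"
    using A by (intro prod_sum_PiE) auto
  also have "\<dots> = (\<Sum>x\<in>pmset n \<rightarrow>\<^sub>E A. \<Prod>k\<in>{1..int n}. g k (x k) (x (- k)))"
  proof (rule sum.reindex_bij_witness[of _
      "\<lambda>x. \<lambda>k\<in>{1..int n}. (x k, x (- k))"
      "\<lambda>c. \<lambda>k\<in>pmset n. if k > 0 then fst (c k) else snd (c (- k))"], goal_cases)
    case (1 c)
    show ?case
    proof
      fix k
      show "(\<lambda>k\<in>{1..int n}. ((\<lambda>k\<in>pmset n. if k > 0 then fst (c k) else snd (c (- k))) k,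
          (\<lambda>k\<in>pmset n. if k > 0 then fst (c k) else snd (c (- k))) (- k))) k = c k"
        using PiE_arb[OF 1, of k] by (cases "k \<in> {1..int n}") (auto simp: pmset_def)
    qed
  next
    case (2 c)
    have "c k \<in> A \<times> A" if "k \<in> {1..int n}" for k using PiE_mem[OF 2 that] .
    then show ?case by (force simp: pmset_def mem_Times_iff)
  next
    case (3 x)
    show ?case
    proof
      fix k
      show "(\<lambda>k\<in>pmset n. if k > 0 then fst ((\<lambda>k\<in>{1..int n}. (x k, x (- k))) k)
          else snd ((\<lambda>k\<in>{1..int n}. (x k, x (- k))) (- k))) k = x k"
        using PiE_arb[OF 3, of k] by (cases "k \<in> pmset n") (auto simp: pmset_def)
    qed
  next
    case (4 x)
    have "x k \<in> A" if "k \<in> pmset n" for k using PiE_mem[OF 4 that] .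
    then show ?case by (auto simp: pmset_def)
  next
    case (5 c)
    show ?case by (intro prod.cong refl) (auto simp: pmset_def)
  qed
  finally show ?thesis .
qed

section \<open>The contribution of one pairing\<close>

text \<open>The index assignments for which the row indices and the signs of any two paired occurrences of
\<open>G\<close> permit a non-zero covariance.\<close>

definition compatible_labels :: "nat \<Rightarrow> (int \<Rightarrow> int) \<Rightarrow> (int \<Rightarrow> 'm \<times> int) set" where
  "compatible_labels n \<alpha> = {x \<in> pmset n \<rightarrow>\<^sub>E UNIV \<times> {1, -1}. \<forall>k\<in>pmset n.
    fst (x k) = fst (x (- \<alpha> k)) \<and> sgn k * snd (x k) = sgn (\<alpha> k) * snd (x (- \<alpha> k))}"

text \<open>A compatible labelling is determined by its matrix indices and by its signs on \<open>FD\<close>, because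
\<open>FD\<close> meets every pair once; the signs there are arbitrary. After the substitution
\<open>h\<^sub>k = sgn(k) snd(x\<^sub>k)\<close> the compatibility condition says that the second sign attached to the
factor \<open>k \<in> FD\<close> is \<open>h\<close> at \<open>inv \<alpha> k\<close>: the entries of the \<open>D\<^sub>k\<close> multiply along the cycles of
\<open>inv \<alpha>\<close>.

The factors agree one \<open>k \<in> {1..n}\<close> at a time. If \<open>k \<in> FD\<close>, the signs from the Wishart entry and
from the covariance cancel. If \<open>-k \<in> FD\<close>, the factor of \<open>Re_tr\<close> is an entry of \<open>D\<^sub>k\<^sup>*\<close>; writing it
as an entry of \<open>D\<^sub>k\<close> yields the product of the two signs of the labelling, and \<open>\<eta>\<^sub>k \<eta>\<^sub>-\<^sub>k\<close> is left.\<close>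

lemma sum_compatible_labels:
  fixes D :: "int \<Rightarrow> quat^'m^'m"
  assumes \<alpha>: "\<alpha> \<in> PM n" and \<eta>: "\<And>k. k \<in> pmset n \<Longrightarrow> \<eta> k \<in> {1, -1}"
  shows "(\<Sum>x\<in>compatible_labels n \<alpha>.
      (\<Prod>k\<in>{1..int n}. of_int (\<eta> k * snd (x k)) *
        quat_entry (D k $ fst (x k) $ fst (x (- k))) (snd (x k)) (snd (x (- k)))) *
      (\<Prod>k\<in>FD n \<alpha>. of_int (snd (x k) * \<eta> k))) =
    of_int (\<Prod>k\<in>{k \<in> {1..int n}. - k \<in> FD n \<alpha>}. \<eta> k * \<eta> (- k)) *
    (\<Sum>i \<in> {i \<in> pmset n \<rightarrow>\<^sub>E (UNIV :: 'm set). \<forall>k\<in>pmset n. i (- k) = i (inv \<alpha> k)}.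
      \<Sum>h \<in> FD n \<alpha> \<rightarrow>\<^sub>E {1, -1}.
        \<Prod>k\<in>FD n \<alpha>. quat_entry (signed_matrix D k $ i k $ i (- k)) (h k) (h (inv \<alpha> k)))"
proof -
  let ?S = "pmset n" and ?F = "FD n \<alpha>"
  let ?I = "{i \<in> ?S \<rightarrow>\<^sub>E (UNIV :: 'm set). \<forall>k\<in>?S. i (- k) = i (inv \<alpha> k)}"
  let ?H = "?F \<rightarrow>\<^sub>E {1, -1 :: int}"
  define T where "T = (\<lambda>(i, h). of_int (\<Prod>k\<in>{k \<in> {1..int n}. - k \<in> ?F}. \<eta> k * \<eta> (- k)) *
    (\<Prod>k\<in>?F. quat_entry (signed_matrix D k $ i k $ i (- k)) (h k) (h (inv \<alpha> k))))"
  define j where "j = (\<lambda>x :: int \<Rightarrow> 'm \<times> int. (\<lambda>k\<in>?S. fst (x k), \<lambda>k\<in>?F. sgn k * snd (x k)))"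
  \<comment> \<open>Off \<open>FD\<close> the sign is read off from the partner \<open>-\<alpha> k\<close>, which does lie in \<open>FD\<close>.\<close>
  define i' where "i' = (\<lambda>(i :: int \<Rightarrow> 'm, h :: int \<Rightarrow> int). \<lambda>k\<in>?S.
    (i k, if k \<in> ?F then sgn k * h k else - sgn k * h (- \<alpha> k)))"
  have FS: "k \<in> ?S" if "k \<in> ?F" for k using that FD_subset by blast
  have nz: "k \<noteq> 0" if "k \<in> ?S" for k using that by auto
  have sgn_S: "sgn k \<in> {1, -1}" if "k \<in> ?S" for k
    using that zero_notin_pmset[of n] by (cases k "0::int" rule: linorder_cases) auto
  have sgn2: "sgn k * (sgn k * z) = z" if "k \<in> ?S" for k z :: int
    using sgn_S[OF that] by auto
  have \<alpha>S: "\<alpha> k \<in> ?S" if "k \<in> ?S" for k using \<alpha> that by simp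
  have notF: "- \<alpha> k \<in> ?F \<longleftrightarrow> k \<notin> ?F" if "k \<in> ?S" for k
    using FD_uminus[OF \<alpha>, of "\<alpha> k"] PM_in_FD_iff[OF \<alpha> that] that \<alpha> by simp
  have invF: "inv \<alpha> k \<in> ?F" if "k \<in> ?F" for k
    using notF[of "- k"] FD_uminus[OF \<alpha>, of k] FS[OF that] that by (simp add: PM_inv[OF \<alpha>])
  have "(\<Sum>x\<in>compatible_labels n \<alpha>.
      (\<Prod>k\<in>{1..int n}. of_int (\<eta> k * snd (x k)) *
        quat_entry (D k $ fst (x k) $ fst (x (- k))) (snd (x k)) (snd (x (- k)))) *
      (\<Prod>k\<in>FD n \<alpha>. of_int (snd (x k) * \<eta> k))) = (\<Sum>ih\<in>?I \<times> ?H. T ih)"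
  proof (rule sum.reindex_bij_witness[of _ i' j], goal_cases)
    case (1 x)
    then have x: "x \<in> ?S \<rightarrow>\<^sub>E UNIV \<times> {1, -1}"
      and c: "\<And>k. k \<in> ?S \<Longrightarrow> sgn k * snd (x k) = sgn (\<alpha> k) * snd (x (- \<alpha> k))"
      by (auto simp: compatible_labels_def)
    show ?case
    proof
      fix k
      show "i' (j x) k = x k"
      proof (cases "k \<in> ?S")
        case False
        then show ?thesis using PiE_arb[OF x] by (simp add: i'_def j_def)
      next
        case k: True
        show ?thesis
        proof (cases "k \<in> ?F")
          case True
          moreover have "k \<noteq> 0" using k by auto
          ultimately show ?thesis using k by (simp add: i'_def j_def sgn2 prod_eq_iff)
        next
          case False
          have "- sgn k * (sgn (- \<alpha> k) * snd (x (- \<alpha> k))) = sgn k * (sgn k * snd (x k))"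
            using c[OF k] by (simp add: sgn_minus)
          moreover have "k \<noteq> 0" using k by auto
          ultimately show ?thesis
            using k False notF[OF k] by (simp add: i'_def j_def sgn2 prod_eq_iff)
        qed
      qed
    qed
  next
    case (2 x)
    then have x: "x \<in> ?S \<rightarrow>\<^sub>E UNIV \<times> {1, -1}"
      and c: "\<And>k. k \<in> ?S \<Longrightarrow> fst (x k) = fst (x (- \<alpha> k))"
      by (auto simp: compatible_labels_def)
    have "fst (x (- k)) = fst (x (inv \<alpha> k))" if "k \<in> ?S" for k
      using c[of "- k"] that by (simp add: PM_inv[OF \<alpha>])
    moreover have "inv \<alpha> k \<in> ?S" if "k \<in> ?S" for k
      using that \<alpha> by (simp add: PM_inv[OF \<alpha>])
    ultimately have "fst (j x) \<in> ?I" by (auto simp: j_def)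
    moreover have "sgn k * snd (x k) \<in> {1, -1}" if "k \<in> ?F" for k
    proof -
      have "snd (x k) \<in> {1, -1}" using PiE_mem[OF x FS[OF that]] by auto
      then show ?thesis using sgn_S[OF FS[OF that]] by auto
    qed
    then have "snd (j x) \<in> ?H" by (auto simp: j_def)
    ultimately show ?case by (simp add: mem_Times_iff)
  next
    case (3 ih)
    obtain i h where ih: "ih = (i, h)" by (cases ih)
    have i: "i \<in> ?S \<rightarrow>\<^sub>E UNIV" and h: "h \<in> ?H" using 3 ih by auto
    have "(\<lambda>k\<in>?S. fst (i' (i, h) k)) = i"
      using PiE_arb[OF i] by (auto simp: i'_def fun_eq_iff restrict_def)
    moreover have "(\<lambda>k\<in>?F. sgn k * snd (i' (i, h) k)) = h"
    proof
      show "(\<lambda>k\<in>?F. sgn k * snd (i' (i, h) k)) k = h k" for k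
        using PiE_arb[OF h, of k] FS[of k] zero_notin_pmset[of n] by (cases "k = 0"; cases "k \<in> ?F") (simp_all add: i'_def sgn2)
    qed
    ultimately show ?case by (simp add: ih j_def)
  next
    case (4 ih)
    obtain i h where ih: "ih = (i, h)" by (cases ih)
    have i: "i (- k) = i (inv \<alpha> k)" if "k \<in> ?S" for k using 4 ih that by auto
    have h: "h k \<in> {1, -1}" if "k \<in> ?F" for k using 4 ih that by (auto simp: PiE_def Pi_def)
    have "i' (i, h) \<in> ?S \<rightarrow>\<^sub>E UNIV \<times> {1, -1}"
    proof (rule PiE_I)
      fix k assume k: "k \<in> ?S"
      show "i' (i, h) k \<in> UNIV \<times> {1, -1}"
        using k sgn_S[OF k] h[of k] h[of "- \<alpha> k"] notF[OF k] by (cases "k \<in> ?F") (auto simp: i'_def)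
    qed (simp add: i'_def)
    moreover have "fst (i' (i, h) k) = fst (i' (i, h) (- \<alpha> k))" if "k \<in> ?S" for k
      using i[of "- k"] that \<alpha> by (simp add: i'_def PM_inv[OF \<alpha>])
    moreover have "sgn k * snd (i' (i, h) k) = sgn (\<alpha> k) * snd (i' (i, h) (- \<alpha> k))"
      if k: "k \<in> ?S" for k
    proof (cases "k \<in> ?F")
      case True
      then have "- \<alpha> k \<notin> ?F" using notF[OF k] by simp
      then show ?thesis
        using True k \<alpha> nz[OF k] nz[OF \<alpha>S[OF k]] by (simp add: i'_def sgn2 PM_uminus[OF \<alpha>] sgn_minus)
    next
      case False
      then have "- \<alpha> k \<in> ?F" using notF[OF k] by simp
      then show ?thesis
        using False k \<alpha> nz[OF k] nz[OF \<alpha>S[OF k]] by (simp add: i'_def sgn_minus)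
    qed
    ultimately show ?case by (simp add: ih compatible_labels_def)
  next
    case (5 x)
    then have x: "x \<in> ?S \<rightarrow>\<^sub>E UNIV \<times> {1, -1}"
      and c: "\<And>k. k \<in> ?S \<Longrightarrow> sgn k * snd (x k) = sgn (\<alpha> k) * snd (x (- \<alpha> k))"
      by (auto simp: compatible_labels_def)
    have snd_x: "snd (x k) \<in> {1, -1}" if "k \<in> ?S" for k using PiE_mem[OF x that] by auto
    define g where "g k = quat_entry (signed_matrix D k $ fst (x k) $ fst (x (- k)))
      (sgn k * snd (x k)) (sgn k * snd (x (- k)))" for k
    have "sgn (inv \<alpha> k) * snd (x (inv \<alpha> k)) = sgn k * snd (x (- k))" if "k \<in> ?S" for k
      using c[of "- k"] that \<alpha> by (simp add: PM_inv[OF \<alpha>] sgn_minus)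
    then have "(\<Prod>k\<in>?F. quat_entry (signed_matrix D k $ fst (j x) k $ fst (j x) (- k))
        (snd (j x) k) (snd (j x) (inv \<alpha> k))) = (\<Prod>k\<in>?F. g k)"
      by (intro prod.cong refl) (simp add: j_def g_def FS invF)
    moreover have "of_int (\<Prod>k\<in>{k \<in> {1..int n}. - k \<in> ?F}. \<eta> k * \<eta> (- k)) =
        (\<Prod>k\<in>{1..int n}. if - k \<in> ?F then of_int (\<eta> k * \<eta> (- k)) else (1 :: complex))"
      unfolding of_int_prod by (rule prod.inter_filter) simp
    ultimately have "T (j x) = (\<Prod>k\<in>{1..int n}. if - k \<in> ?F then of_int (\<eta> k * \<eta> (- k)) else 1) * (\<Prod>k\<in>?F. g k)"
      unfolding T_def case_prod_beta' by (simp only:)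
    also have "\<dots> = (\<Prod>k\<in>{1..int n}. (if - k \<in> ?F then of_int (\<eta> k * \<eta> (- k)) else 1) *
        (if k \<in> ?F then g k else g (- k)))"
      by (simp add: prod_FD[OF \<alpha>] prod.distrib)
    also have "\<dots> = (\<Prod>k\<in>{1..int n}. (of_int (\<eta> k * snd (x k)) *
        quat_entry (D k $ fst (x k) $ fst (x (- k))) (snd (x k)) (snd (x (- k)))) *
        (if k \<in> ?F then of_int (snd (x k) * \<eta> k) else of_int (snd (x (- k)) * \<eta> (- k))))"
    proof (rule prod.cong[OF refl])
      fix k assume k: "k \<in> {1..int n}"
      then have S: "k \<in> ?S" "- k \<in> ?S" "k > 0" by (auto simp: pmset_def)
      note signs = snd_x[OF S(1)] snd_x[OF S(2)] \<eta>[OF S(1)] \<eta>[OF S(2)]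
      show "(if - k \<in> ?F then of_int (\<eta> k * \<eta> (- k)) else 1) * (if k \<in> ?F then g k else g (- k)) =
        (of_int (\<eta> k * snd (x k)) *
        quat_entry (D k $ fst (x k) $ fst (x (- k))) (snd (x k)) (snd (x (- k)))) *
        (if k \<in> ?F then of_int (snd (x k) * \<eta> k) else of_int (snd (x (- k)) * \<eta> (- k)))"
      proof (cases "k \<in> ?F")
        case True
        then have "- k \<notin> ?F" using FD_uminus[OF \<alpha> S(1)] by simp
        moreover have "g k = quat_entry (D k $ fst (x k) $ fst (x (- k))) (snd (x k)) (snd (x (- k)))"
          using S(3) by (simp add: g_def signed_matrix_def)
        moreover have "of_int (\<eta> k * snd (x k)) * z * of_int (snd (x k) * \<eta> k) = z" for z :: complex
          using signs by auto
        ultimately show ?thesis using True by (simp only: if_True if_False mult_1_left)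
      next
        case False
        then have "- k \<in> ?F" using FD_uminus[OF \<alpha> S(1)] by simp
        moreover have "g (- k) = of_int (snd (x (- k)) * snd (x k)) *
            quat_entry (D k $ fst (x k) $ fst (x (- k))) (snd (x k)) (snd (x (- k)))"
          using S(3) quat_entry_qcnj[of "- snd (x (- k))" "- snd (x k)" "D k $ fst (x k) $ fst (x (- k))"] signs
          by (auto simp: g_def signed_matrix_def conj_transpose_def)
        ultimately show ?thesis using False by (simp add: mult_ac)
      qed
    qed
    also have "\<dots> = (\<Prod>k\<in>{1..int n}. of_int (\<eta> k * snd (x k)) *
        quat_entry (D k $ fst (x k) $ fst (x (- k))) (snd (x k)) (snd (x (- k)))) *
      (\<Prod>k\<in>FD n \<alpha>. of_int (snd (x k) * \<eta> k))"
      by (simp only: prod.distrib prod_FD[OF \<alpha>])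
    finally show ?case .
  qed
  also have "\<dots> = of_int (\<Prod>k\<in>{k \<in> {1..int n}. - k \<in> FD n \<alpha>}. \<eta> k * \<eta> (- k)) *
    (\<Sum>i \<in> ?I. \<Sum>h \<in> ?H.
        \<Prod>k\<in>FD n \<alpha>. quat_entry (signed_matrix D k $ i k $ i (- k)) (h k) (h (inv \<alpha> k)))"
    unfolding T_def by (simp only: sum.cartesian_product sum_distrib_left case_prod_beta')
  finally show ?thesis .
qed

lemma finite_PM [simp]: "finite (PM n)"
  by (rule finite_subset[OF _ finite_permutations[OF finite_pmset[of n]]]) (auto simp: PM_def)

lemma entry_cov_sym: "entry_cov u v = entry_cov v u"
  by (cases u; cases v) (auto simp: entry_cov_def)

text \<open>The numerator on the right undoes the normalisation of \<open>Re_tr\<close>; \<open>N\<close> to the power \<open>n\<close> comes from the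
Wishart matrices and \<open>2\<close> to the power \<open>n\<close> from the covariances of the \<open>n\<close> pairs. The exponent on the
left is an integer because \<open>\<alpha>\<close> has an even number of cycles on \<open>pmset n\<close>.\<close>

lemma wishart_normalisation:
  assumes "\<alpha> \<in> PM n" "N > 0"
  shows "complex_of_real ((2 * real N) powr (real (num_orbits \<alpha> (pmset n)) / 2 - real n)) =
    2 ^ num_orbits \<alpha> (FD n \<alpha>) * of_nat N ^ num_orbits \<alpha> (FD n \<alpha>) / (2 ^ n * of_nat N ^ n)"
  using assms by (simp add: num_orbits_pmset powr_diff powr_realpow power_mult_distrib)

text \<open>For \<open>l = -\<alpha> k\<close> one has \<open>sgn l = -sgn(\<alpha> k)\<close>, so the requirement of opposite signs in \<open>entry_cov\<close>
becomes \<open>sgn(k) \<eta>\<^sub>k = sgn(\<alpha> k) \<eta>\<^sub>l\<close>, and similarly for the labels. Each pair is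
represented by its element in \<open>FD\<close>.\<close>

lemma prod_entry_cov_negate_on:
  fixes x :: "int \<Rightarrow> 'm \<times> int" and \<iota> :: "int \<Rightarrow> 'n" and \<eta> :: "int \<Rightarrow> int"
  assumes \<alpha>: "\<alpha> \<in> PM n"
  defines "slot \<equiv> \<lambda>k. (fst (x k), \<iota> k, - sgn k * snd (x k), - sgn k * \<eta> k)"
  shows "(\<Prod>k\<in>{k\<in>pmset n. k < negate_on n \<alpha> k}. entry_cov (slot k) (slot (negate_on n \<alpha> k))) =
    (if (\<forall>k\<in>pmset n. fst (x k) = fst (x (- \<alpha> k)) \<and> sgn k * snd (x k) = sgn (\<alpha> k) * snd (x (- \<alpha> k))) \<and>
        (\<forall>k\<in>pmset n. \<iota> k = \<iota> (- \<alpha> k)) \<and> (\<forall>k\<in>pmset n. sgn k * \<eta> k = sgn (\<alpha> k) * \<eta> (- \<alpha> k))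
     then (\<Prod>k\<in>FD n \<alpha>. of_int (snd (x k) * \<eta> k)) / 2 ^ n else 0)"
proof -
  define Q where "Q k \<longleftrightarrow> (fst (x k) = fst (x (- \<alpha> k)) \<and> sgn k * snd (x k) = sgn (\<alpha> k) * snd (x (- \<alpha> k))) \<and>
    \<iota> k = \<iota> (- \<alpha> k) \<and> sgn k * \<eta> k = sgn (\<alpha> k) * \<eta> (- \<alpha> k)" for k
  have Q_sym: "Q (- \<alpha> k) \<longleftrightarrow> Q k" if "k \<in> pmset n" for k
    unfolding Q_def PM_sign_condition_uminus[OF \<alpha> that] by (auto simp: PM_uminus[OF \<alpha>])
  have Q_all: "(\<forall>k\<in>FD n \<alpha>. Q k) \<longleftrightarrow> (\<forall>k\<in>pmset n. Q k)"
    using \<alpha> Q_sym by (rule PM_all_FD_iff)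
  have fin: "finite (FD n \<alpha>)" using finite_subset[OF FD_subset finite_pmset] .
  have F: "negate_on n \<alpha> k \<in> FD n \<alpha> \<longleftrightarrow> k \<notin> FD n \<alpha>" if "k \<in> pmset n" for k
    using FD_uminus[OF \<alpha>, of "\<alpha> k"] PM_in_FD_iff[OF \<alpha> that] that \<alpha> by (simp add: negate_on_def)
  have "(\<Prod>k\<in>{k\<in>pmset n. k < negate_on n \<alpha> k}. entry_cov (slot k) (slot (negate_on n \<alpha> k))) =
      (\<Prod>k\<in>FD n \<alpha>. entry_cov (slot k) (slot (negate_on n \<alpha> k)))"
    by (rule prod_pairing_transversal[OF negate_on_PM[OF \<alpha>] FD_subset F entry_cov_sym])
  also have "\<dots> = (\<Prod>k\<in>FD n \<alpha>. if Q k then of_int (snd (x k) * \<eta> k) / 2 else 0)"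
  proof (rule prod.cong[OF refl])
    fix k assume "k \<in> FD n \<alpha>"
    then have k: "k \<in> pmset n" using FD_subset by blast
    then have "sgn k * sgn k = 1" by (auto simp: sgn_if)
    then have "(- sgn k * a) * (- sgn k * b) = a * b" for a b :: int
      by (metis minus_mult_minus mult.assoc mult.left_commute mult_1 mult_minus_left)
    moreover have "entry_cov (slot k) (slot (negate_on n \<alpha> k)) =
        (if Q k then of_int ((- sgn k * snd (x k)) * (- sgn k * \<eta> k)) / 2 else 0)"
      unfolding entry_cov_def slot_def prod.case
      by (rule if_cong) (use k in \<open>auto simp: negate_on_def Q_def sgn_minus\<close>)
    ultimately show "entry_cov (slot k) (slot (negate_on n \<alpha> k)) = (if Q k then of_int (snd (x k) * \<eta> k) / 2 else 0)"
      by (simp only:)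
  qed
  also have "\<dots> = (if \<forall>k\<in>pmset n. Q k then \<Prod>k\<in>FD n \<alpha>. of_int (snd (x k) * \<eta> k) / 2 else 0)"
    by (simp only: prod_if_zero[OF fin] Q_all)
  also have "(\<Prod>k\<in>FD n \<alpha>. of_int (snd (x k) * \<eta> k) / 2) =
      (\<Prod>k\<in>FD n \<alpha>. of_int (snd (x k) * \<eta> k)) / (\<Prod>k\<in>FD n \<alpha>. 2 :: complex)"
    by (rule prod_dividef)
  also have "(\<Prod>k\<in>FD n \<alpha>. 2 :: complex) = 2 ^ n"
    unfolding prod_FD[OF \<alpha>] by simp
  finally show ?thesis unfolding Q_def by (simp only: ball_conj_distrib)
qed

theorem proposition5p9:
  fixes P :: "'w measure"
    and G :: "'w \<Rightarrow> quat^'n^'m"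
    and n :: nat
    and D :: "int \<Rightarrow> quat^'m^'m"
    and \<iota> :: "int \<Rightarrow> 'n"
    and \<eta> :: "int \<Rightarrow> int"
  assumes "prob_space P"
    and "quat_gaussian_matrix P G"
    and "\<forall>k\<in>pmset n. \<eta> k \<in> {1, -1}"
  defines "W \<equiv> (\<lambda>k w. wishart (G w) (D k))"
    and "f \<equiv> (\<lambda>\<alpha>. Re_tr CARD('n) n (inv \<alpha>) (inv \<alpha>) D)"
  shows
    "integrable P (\<lambda>w. \<Prod>k\<in>{1..int n}. quat_entry (W k w $ \<iota> k $ \<iota> (- k)) (\<eta> k) (\<eta> (- k))) \<and>
     prob_space.expectation P
       (\<lambda>w. \<Prod>k\<in>{1..int n}. quat_entry (W k w $ \<iota> k $ \<iota> (- k)) (\<eta> k) (\<eta> (- k))) =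
     (\<Sum>\<alpha> \<in> {\<alpha> \<in> PM n.
          (\<forall>k\<in>pmset n. \<iota> k = \<iota> (- \<alpha> k)) \<and>
          (\<forall>k\<in>pmset n. sgn k * \<eta> k = sgn (\<alpha> k) * \<eta> (- \<alpha> k))}.
        complex_of_real
          ((2 * real CARD('n)) powr (real (num_orbits \<alpha> (pmset n)) / 2 - real n)) *
        of_int (\<Prod>k\<in>{k \<in> {1..int n}. - k \<in> FD n \<alpha>}. \<eta> k * \<eta> (- k)) *
        f \<alpha>)"
proof -
  let ?S = "pmset n" and ?N = "of_nat CARD('n) :: complex"
  let ?A = "UNIV \<times> {1, -1} :: ('m \<times> int) set"
  have \<eta>: "\<eta> k \<in> {1, -1}" if "k \<in> ?S" for k using assms(3) that by blast
  define c where "c x = (\<Prod>k\<in>{1..int n}. of_int (\<eta> k * snd (x k)) *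
    quat_entry (D k $ fst (x k) $ fst (x (- k))) (snd (x k)) (snd (x (- k))))" for x :: "int \<Rightarrow> 'm \<times> int"
  \<comment> \<open>The entry of \<open>G\<close> occurring at the signed position \<open>k\<close>. For \<open>k > 0\<close> it comes from \<open>G\<^sup>*\<close>,
    whence the negated signs.\<close>
  define slot where "slot x k = (fst (x k), \<iota> k, - sgn k * snd (x k), - sgn k * \<eta> k)"
    for x :: "int \<Rightarrow> 'm \<times> int" and k
  define good where "good \<alpha> \<longleftrightarrow> (\<forall>k\<in>?S. \<iota> k = \<iota> (- \<alpha> k)) \<and>
    (\<forall>k\<in>?S. sgn k * \<eta> k = sgn (\<alpha> k) * \<eta> (- \<alpha> k))" for \<alpha>
  have expand: "(\<Prod>k\<in>{1..int n}. quat_entry (W k w $ \<iota> k $ \<iota> (- k)) (\<eta> k) (\<eta> (- k))) =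
      (\<Sum>x\<in>?S \<rightarrow>\<^sub>E ?A. c x / ?N ^ n *
        (\<Prod>k\<in>?S. quat_entry (G w $ fst (x k) $ \<iota> k) (- sgn k * snd (x k)) (- sgn k * \<eta> k)))" for w
  proof -
    define g where "g k y z = of_int (\<eta> k * snd y) * quat_entry (D k $ fst y $ fst z) (snd y) (snd z) / ?N *
      (quat_entry (G w $ fst y $ \<iota> k) (- snd y) (- \<eta> k) *
       quat_entry (G w $ fst z $ \<iota> (- k)) (snd z) (\<eta> (- k)))" for k and y z :: "'m \<times> int"
    have "(\<Prod>k\<in>{1..int n}. quat_entry (W k w $ \<iota> k $ \<iota> (- k)) (\<eta> k) (\<eta> (- k))) =
        (\<Prod>k\<in>{1..int n}. \<Sum>y\<in>?A. \<Sum>z\<in>?A. g k y z)"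
      unfolding W_def g_def
      by (intro prod.cong refl wishart_entry \<eta>) (auto simp: pmset_def)
    also have "\<dots> = (\<Sum>x\<in>?S \<rightarrow>\<^sub>E ?A. \<Prod>k\<in>{1..int n}. g k (x k) (x (- k)))"
      by (rule prod_sum_sum_pmset) simp
    also have "\<dots> = (\<Sum>x\<in>?S \<rightarrow>\<^sub>E ?A. c x / ?N ^ n *
        (\<Prod>k\<in>?S. quat_entry (G w $ fst (x k) $ \<iota> k) (- sgn k * snd (x k)) (- sgn k * \<eta> k)))"
      unfolding g_def c_def prod_pmset
      by (intro sum.cong refl) (simp add: prod.distrib prod_dividef)
    finally show ?thesis .
  qed
  have slot_signs: "- sgn k * snd (x k) \<in> {1, -1}" "- sgn k * \<eta> k \<in> {1, -1}"
    if x: "x \<in> ?S \<rightarrow>\<^sub>E ?A" and k: "k \<in> ?S" for x :: "int \<Rightarrow> 'm \<times> int" and k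
  proof -
    have "k \<noteq> 0" using k by auto
    then have "sgn k \<in> {1, -1}" by (auto simp: sgn_if)
    moreover have "snd (x k) \<in> {1, -1}" using PiE_mem[OF x k] by auto
    ultimately show "- sgn k * snd (x k) \<in> {1, -1}" "- sgn k * \<eta> k \<in> {1, -1}"
      using \<eta>[OF k] by auto
  qed
  have "has_bochner_integral P (\<lambda>w. \<Prod>k\<in>{1..int n}. quat_entry (W k w $ \<iota> k $ \<iota> (- k)) (\<eta> k) (\<eta> (- k)))
    (\<Sum>x\<in>?S \<rightarrow>\<^sub>E ?A. c x / ?N ^ n *
      (\<Sum>p\<in>pairings ?S. \<Prod>k\<in>{k\<in>?S. k < p k}. entry_cov (slot x k) (slot x (p k))))"
    unfolding expand slot_def
    by (intro has_bochner_integral_sum has_bochner_integral_mult_right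
      quat_gaussian_matrix_wick assms(1,2) finite_pmset slot_signs)
  also have "(\<Sum>x\<in>?S \<rightarrow>\<^sub>E ?A. c x / ?N ^ n *
      (\<Sum>p\<in>pairings ?S. \<Prod>k\<in>{k\<in>?S. k < p k}. entry_cov (slot x k) (slot x (p k)))) =
    (\<Sum>\<alpha>\<in>PM n. \<Sum>x\<in>?S \<rightarrow>\<^sub>E ?A. c x / ?N ^ n * (\<Prod>k\<in>{k\<in>?S. k < negate_on n \<alpha> k}.
      entry_cov (slot x k) (slot x (negate_on n \<alpha> k))))"
    unfolding sum_pairings_pmset sum_distrib_left by (rule sum.swap)
  also have "\<dots> = (\<Sum>\<alpha>\<in>PM n. if good \<alpha> then
      complex_of_real ((2 * real CARD('n)) powr (real (num_orbits \<alpha> ?S) / 2 - real n)) *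
        of_int (\<Prod>k\<in>{k \<in> {1..int n}. - k \<in> FD n \<alpha>}. \<eta> k * \<eta> (- k)) * f \<alpha> else 0)"
  proof (rule sum.cong[OF refl])
    fix \<alpha> assume \<alpha>: "\<alpha> \<in> PM n"
    have fin: "finite (?S \<rightarrow>\<^sub>E ?A)" by (intro finite_PiE) auto
    have "(\<Sum>x\<in>?S \<rightarrow>\<^sub>E ?A. c x / ?N ^ n * (\<Prod>k\<in>{k\<in>?S. k < negate_on n \<alpha> k}.
        entry_cov (slot x k) (slot x (negate_on n \<alpha> k)))) =
      (\<Sum>x\<in>?S \<rightarrow>\<^sub>E ?A. if \<forall>k\<in>?S. fst (x k) = fst (x (- \<alpha> k)) \<and> sgn k * snd (x k) = sgn (\<alpha> k) * snd (x (- \<alpha> k))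
        then (if good \<alpha> then c x * (\<Prod>k\<in>FD n \<alpha>. of_int (snd (x k) * \<eta> k)) / (2 ^ n * ?N ^ n) else 0) else 0)"
      unfolding slot_def prod_entry_cov_negate_on[OF \<alpha>] good_def
      by (intro sum.cong refl) (auto simp: field_simps)
    also have "\<dots> = (\<Sum>x\<in>compatible_labels n \<alpha>.
        if good \<alpha> then c x * (\<Prod>k\<in>FD n \<alpha>. of_int (snd (x k) * \<eta> k)) / (2 ^ n * ?N ^ n) else 0)"
      unfolding compatible_labels_def by (rule sum.inter_filter[OF fin, symmetric])
    also have "\<dots> = (if good \<alpha> then (\<Sum>x\<in>compatible_labels n \<alpha>.
        c x * (\<Prod>k\<in>FD n \<alpha>. of_int (snd (x k) * \<eta> k))) / (2 ^ n * ?N ^ n) else 0)"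
      by (simp add: sum_divide_distrib)
    also have "(\<Sum>x\<in>compatible_labels n \<alpha>. c x * (\<Prod>k\<in>FD n \<alpha>. of_int (snd (x k) * \<eta> k))) / (2 ^ n * ?N ^ n) =
      complex_of_real ((2 * real CARD('n)) powr (real (num_orbits \<alpha> ?S) / 2 - real n)) *
        of_int (\<Prod>k\<in>{k \<in> {1..int n}. - k \<in> FD n \<alpha>}. \<eta> k * \<eta> (- k)) * f \<alpha>"
    proof -
      have "(\<Sum>x\<in>compatible_labels n \<alpha>. c x * (\<Prod>k\<in>FD n \<alpha>. of_int (snd (x k) * \<eta> k))) =
        of_int (\<Prod>k\<in>{k \<in> {1..int n}. - k \<in> FD n \<alpha>}. \<eta> k * \<eta> (- k)) *
        (\<Sum>i \<in> {i \<in> ?S \<rightarrow>\<^sub>E (UNIV :: 'm set). \<forall>k\<in>?S. i (- k) = i (inv \<alpha> k)}.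
          \<Sum>h \<in> FD n \<alpha> \<rightarrow>\<^sub>E {1, -1}.
            \<Prod>k\<in>FD n \<alpha>. quat_entry (signed_matrix D k $ i k $ i (- k)) (h k) (h (inv \<alpha> k)))"
        unfolding c_def by (rule sum_compatible_labels[OF \<alpha> \<eta>])
      then show ?thesis
        unfolding f_def Re_tr_def FD_inv[OF \<alpha>] num_orbits_inv[OF \<alpha>]
          wishart_normalisation[OF \<alpha> zero_less_card_finite]
        by simp
    qed
    finally show "(\<Sum>x\<in>?S \<rightarrow>\<^sub>E ?A. c x / ?N ^ n * (\<Prod>k\<in>{k\<in>?S. k < negate_on n \<alpha> k}.
        entry_cov (slot x k) (slot x (negate_on n \<alpha> k)))) =
      (if good \<alpha> then
      complex_of_real ((2 * real CARD('n)) powr (real (num_orbits \<alpha> ?S) / 2 - real n)) *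
        of_int (\<Prod>k\<in>{k \<in> {1..int n}. - k \<in> FD n \<alpha>}. \<eta> k * \<eta> (- k)) * f \<alpha> else 0)" .
  qed
  also have "\<dots> = (\<Sum>\<alpha> \<in> {\<alpha> \<in> PM n. good \<alpha>}.
        complex_of_real ((2 * real CARD('n)) powr (real (num_orbits \<alpha> ?S) / 2 - real n)) *
        of_int (\<Prod>k\<in>{k \<in> {1..int n}. - k \<in> FD n \<alpha>}. \<eta> k * \<eta> (- k)) * f \<alpha>)"
    by (rule sum.inter_filter[symmetric]) simp
  finally show ?thesis
    unfolding good_def by (simp add: has_bochner_integral_iff)
qed

end
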